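(* Let $(X,\rho)$ be a nonempty separable metric space, $I$ a finite set with at least two elements, $\{X,S_i,p_i\}_{i\in I}$ a measurable iterated function system with an invariant probability measure $\mu$, and let $\nu$ be the probability measure on $X\times\Sigma$, $\Sigma=I^{\mathbb N}$, given by $\nu(d(x,\omega))=p_x(d\omega)\,\mu(dx)$. Then $\mu$ is ergodic with respect to $\{X,S_i,p_i\}$ if and only if $\nu$ is ergodic for $(X\times\Sigma,S)$, where $S(x,\omega)=(S_{\omega_1}(x),\sigma\omega)$.
   Context: A (measurable) iterated function system $\{X,S_i,p_i\}_{i\in I}$ consists of Borel measurable maps $S_i:X\to X$ and Borel measurable functions $p_i:X\to[0,1]$ with $\sum_{i\in I}p_i\equiv1$. Its transition probability function is $P(x,A)=\sum_{i\in I}p_i(x)1_A(S_i(x))$, and $P$ acts on finite Borel measures by $\mu P(A)=\int_X P(x,A)\,\mu(dx)$. A measure $\mu$ is invariant if $\mu P=\mu$. An invariant probability measure is ergodic with respect to the system if it is an extremal point of the set of invariant probability measures. $\mathbb N=\{1,2,\ldots\}$; $\Sigma=I^{\mathbb N}$ carries the product topology ($I$ discrete), and $\sigma$ is the left shift $(\sigma\omega)_n=\omega_{n+1}$. For $\omega^n=(\omega_1,\ldots,\omega_n)\in I^n$, $C_{\omega^n}$ is the cylinder of all $\xi\in\Sigma$ whose first $n$ terms are $\omega_1,\ldots,\omega_n$; $S_{\omega^n}=S_{\omega_n}\circ\cdots\circ S_{\omega_1}$; and $p_{\omega^n}(x)=p_{\omega_1}(x)\,p_{\omega_2}(S_{\omega_1}(x))\cdots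 p_{\omega_n}(S_{\omega^{n-1}}(x))$. For $x\in X$, $p_x$ is the Borel probability measure on $\Sigma$ determined by $p_x(C_{\omega^n})=p_{\omega^n}(x)$ for all $n$ and $\omega^n\in I^n$. The measure $\nu$ is invariant under the skew product $S$; ergodicity of $\nu$ for $(X\times\Sigma,S)$ is the usual ergodicity of a measure-preserving transformation. *)

theory Defs
  imports "HOL-Probability.Probability"
begin

text \<open>
  The index set is a finite type of class \<open>discrete_topology\<close>, so the class topology of
  \<open>nat \<Rightarrow> 'i\<close> is the product topology on sequences over a discrete alphabet, and
  \<open>borel\<close> denotes the Borel sigma-algebra on the state space, on the sequence space, and on
  their topological product. Sequences are indexed from 0: the first symbol of \<open>\<omega>\<close> is \<open>\<omega> 0\<close>.
\<close>

definition measurable_ifs ::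
    "('i::finite \<Rightarrow> 'a::topological_space \<Rightarrow> 'a) \<Rightarrow> ('i \<Rightarrow> 'a \<Rightarrow> real) \<Rightarrow> bool" where
  "measurable_ifs S p \<longleftrightarrow>
     (\<forall>i. S i \<in> borel_measurable borel) \<and>
     (\<forall>i. p i \<in> borel_measurable borel) \<and>
     (\<forall>i x. 0 \<le> p i x \<and> p i x \<le> 1) \<and>
     (\<forall>x. (\<Sum>i\<in>UNIV. p i x) = 1)"

definition ifs_transition ::
    "('i::finite \<Rightarrow> 'a \<Rightarrow> 'a) \<Rightarrow> ('i \<Rightarrow> 'a \<Rightarrow> real) \<Rightarrow> 'a \<Rightarrow> 'a set \<Rightarrow> real" where
  "ifs_transition S p x A = (\<Sum>i\<in>UNIV. p i x * indicator A (S i x))"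

definition ifs_action ::
    "('i::finite \<Rightarrow> 'a::topological_space \<Rightarrow> 'a) \<Rightarrow> ('i \<Rightarrow> 'a \<Rightarrow> real) \<Rightarrow> 'a measure \<Rightarrow> 'a measure" where
  "ifs_action S p \<mu> =
     measure_of UNIV (sets borel) (\<lambda>A. \<integral>\<^sup>+ x. ennreal (ifs_transition S p x A) \<partial>\<mu>)"

definition ifs_invariant_probs ::
    "('i::finite \<Rightarrow> 'a::topological_space \<Rightarrow> 'a) \<Rightarrow> ('i \<Rightarrow> 'a \<Rightarrow> real) \<Rightarrow> 'a measure set" where
  "ifs_invariant_probs S p =
     {\<mu>. prob_space \<mu> \<and> sets \<mu> = sets borel \<and> ifs_action S p \<mu> = \<mu>}"

text \<open>
  The type of measures is not a real vector space, so extremality is spelled out: \<open>\<mu>\<close> is not a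
  proper convex combination of two distinct invariant probability measures.
\<close>

definition ifs_ergodic ::
    "('i::finite \<Rightarrow> 'a::topological_space \<Rightarrow> 'a) \<Rightarrow> ('i \<Rightarrow> 'a \<Rightarrow> real) \<Rightarrow> 'a measure \<Rightarrow> bool" where
  "ifs_ergodic S p \<mu> \<longleftrightarrow>
     \<mu> \<in> ifs_invariant_probs S p \<and>
     \<not> (\<exists>\<mu>1 \<in> ifs_invariant_probs S p. \<exists>\<mu>2 \<in> ifs_invariant_probs S p. \<exists>t::real.
          \<mu>1 \<noteq> \<mu>2 \<and> 0 < t \<and> t < 1 \<and>
          (\<forall>A \<in> sets borel. measure \<mu> A = t * measure \<mu>1 A + (1 - t) * measure \<mu>2 A))"

definition cylinder :: "'i list \<Rightarrow> (nat \<Rightarrow> 'i) set" where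
  "cylinder w = {\<xi>. \<forall>k < length w. \<xi> k = w ! k}"

text \<open>The first letter of the word acts first.\<close>

definition word_map :: "('i \<Rightarrow> 'a \<Rightarrow> 'a) \<Rightarrow> 'i list \<Rightarrow> 'a \<Rightarrow> 'a" where
  "word_map S w = fold S w"

definition word_weight ::
    "('i \<Rightarrow> 'a \<Rightarrow> 'a) \<Rightarrow> ('i \<Rightarrow> 'a \<Rightarrow> real) \<Rightarrow> 'i list \<Rightarrow> 'a \<Rightarrow> real" where
  "word_weight S p w x = (\<Prod>k < length w. p (w ! k) (word_map S (take k w) x))"

text \<open>
  For a measurable iterated function system a measure with these cylinder values exists
  (Kolmogorov extension) and is unique, so the description below is proper; otherwise the value
  is unspecified.
\<close>

definition path_measure ::
    "('i::{finite,discrete_topology} \<Rightarrow> 'a \<Rightarrow> 'a) \<Rightarrow> ('i \<Rightarrow> 'a \<Rightarrow> real) \<Rightarrow> 'a \<Rightarrow> (nat \<Rightarrow> 'i) measure"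
  where
  "path_measure S p x =
     (THE M. prob_space M \<and> sets M = sets borel \<and>
        (\<forall>w. measure M (cylinder w) = word_weight S p w x))"

definition skew_measure ::
    "('i::{finite,discrete_topology} \<Rightarrow> 'a::topological_space \<Rightarrow> 'a) \<Rightarrow> ('i \<Rightarrow> 'a \<Rightarrow> real) \<Rightarrow>
     'a measure \<Rightarrow> ('a \<times> (nat \<Rightarrow> 'i)) measure" where
  "skew_measure S p \<mu> =
     measure_of UNIV (sets borel)
       (\<lambda>A. \<integral>\<^sup>+ x. emeasure (path_measure S p x) {\<omega>. (x, \<omega>) \<in> A} \<partial>\<mu>)"

definition skew_product ::
    "('i \<Rightarrow> 'a \<Rightarrow> 'a) \<Rightarrow> 'a \<times> (nat \<Rightarrow> 'i) \<Rightarrow> 'a \<times> (nat \<Rightarrow> 'i)" where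
  "skew_product S = (\<lambda>(x, \<omega>). (S (\<omega> 0) x, \<lambda>n. \<omega> (Suc n)))"

definition ergodic_transformation :: "'b measure \<Rightarrow> ('b \<Rightarrow> 'b) \<Rightarrow> bool" where
  "ergodic_transformation M T \<longleftrightarrow>
     prob_space M \<and> T \<in> measurable M M \<and> distr M M T = M \<and>
     (\<forall>A \<in> sets M. T -` A \<inter> space M = A \<longrightarrow> measure M A = 0 \<or> measure M A = 1)"

end

theory Submission
  imports Defs
begin

text \<open>
  Write \<open>T\<close> for the skew product, \<open>p\<^sub>x\<close> for the path measure started at \<open>x\<close> and \<open>\<nu>\<close> for the skew
  measure over \<open>\<mu>\<close>. Everything rests on the first-step decomposition of \<open>p\<^sub>x\<close>
  (\<open>nn_integral_path_measure\<close>): draw a letter \<open>i\<close> with probability \<open>p\<^sub>i(x)\<close>, then continue with a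
  path from \<open>S\<^sub>i(x)\<close>. It shows that \<open>\<mu>P\<close> is the law of the first coordinate of \<open>T\<close> under \<open>\<nu>\<close>,
  and that invariance of \<open>\<mu>\<close> makes \<open>\<nu>\<close> invariant under \<open>T\<close>.

  If \<open>\<nu>\<close> is ergodic and \<open>\<mu> = t \<mu>\<^sub>1 + (1 - t) \<mu>\<^sub>2\<close>, then the skew measures over \<open>\<mu>\<^sub>1\<close> and \<open>\<mu>\<^sub>2\<close> are
  invariant and absolutely continuous with respect to \<open>\<nu>\<close>, so on every invariant set they both take
  the value 0 or both the value 1. Two invariant probability measures that agree on the invariant
  sets are equal (\<open>invariant_measures_eqI\<close>): a set of a Hahn decomposition of their difference can
  be replaced by an invariant one. Projecting to the first coordinate gives \<open>\<mu>\<^sub>1 = \<mu>\<^sub>2\<close>.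

  Conversely, let \<open>A\<close> be a \<open>T\<close>-invariant set and \<open>h(x) = p\<^sub>x {\<omega>. (x, \<omega>) \<in> A}\<close>. By the Markov
  property \<open>h(S\<^bsub>\<omega>\<^sup>n\<^esub> x)\<close> is the conditional expectation of the indicator of \<open>A\<close> given \<open>x\<close> and the first
  \<open>n\<close> letters. Hence the measures with densities \<open>h \<circ> fst \<circ> T\<^sup>n\<close> with respect to \<open>\<nu>\<close> agree with
  the restriction of \<open>\<nu>\<close> to \<open>A\<close> on rectangles over cylinders as soon as \<open>n\<close> is large, and converge
  to it on all measurable sets (\<open>density_tendsto_invariant_set\<close>). Their value on \<open>A\<close> is \<open>\<integral>h\<^sup>2 d\<mu>\<close>
  for every \<open>n\<close>, because \<open>\<nu>\<close> and \<open>A\<close> are invariant, while the limit is \<open>\<nu>(A) = \<integral>h d\<mu>\<close>. As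
  \<open>0 \<le> h \<le> 1\<close>, this forces \<open>h\<close> to be 0 or 1 almost everywhere. A harmonic function with this
  property is constant along the transitions of the system, so if \<open>0 < \<nu>(A) < 1\<close>, normalising
  \<open>h \<mu>\<close> and \<open>(1 - h) \<mu>\<close> splits \<open>\<mu>\<close> into two distinct invariant probability measures
  (\<open>not_ifs_ergodic_if_zero_one_function\<close>).
\<close>

section \<open>Borel sets of sequence spaces\<close>

lemma cylinder_Nil: "cylinder [] = UNIV"
  by (simp add: cylinder_def)

lemma cylinder_Cons: "\<omega> \<in> cylinder (j # w) \<longleftrightarrow> \<omega> 0 = j \<and> (\<lambda>n. \<omega> (Suc n)) \<in> cylinder w"
  by (auto simp: cylinder_def nth_Cons split: nat.splits)

lemma open_cylinder: "open (cylinder w :: (nat \<Rightarrow> 'i::discrete_topology) set)"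
proof -
  have "open {\<xi>::nat \<Rightarrow> 'i. \<xi> k = w ! k}" for k
  proof -
    have "open ((\<lambda>\<xi>::nat \<Rightarrow> 'i. \<xi> k) -` {w ! k})"
      by (intro open_vimage discrete_topology_class.open_discrete continuous_on_product_coordinates)
    moreover have "(\<lambda>\<xi>::nat \<Rightarrow> 'i. \<xi> k) -` {w ! k} = {\<xi>. \<xi> k = w ! k}"
      by auto
    ultimately show ?thesis by simp
  qed
  then have "open (\<Inter>k\<in>{..<length w}. {\<xi>::nat \<Rightarrow> 'i. \<xi> k = w ! k})"
    by (intro open_INT) auto
  also have "(\<Inter>k\<in>{..<length w}. {\<xi>. \<xi> k = w ! k}) = cylinder w"
    by (auto simp: cylinder_def)
  finally show ?thesis .
qed

lemma open_contains_cylinder: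
  fixes U :: "(nat \<Rightarrow> 'i::discrete_topology) set"
  assumes "open U" "\<omega> \<in> U"
  shows "\<exists>w. \<omega> \<in> cylinder w \<and> cylinder w \<subseteq> U"
proof -
  have "openin (product_topology (\<lambda>_. euclidean) UNIV) U"
    using assms(1) by (simp add: open_fun_def)
  from product_topology_open_contains_basis[OF this assms(2)]
  obtain X where X: "\<omega> \<in> (\<Pi>\<^sub>E i\<in>UNIV. X i)" "finite {i. X i \<noteq> (UNIV :: 'i set)}" "(\<Pi>\<^sub>E i\<in>UNIV. X i) \<subseteq> U"
    by auto
  from X(2) obtain n where n: "\<And>i. X i \<noteq> UNIV \<Longrightarrow> i < n"
    by (metis (mono_tags, lifting) finite_nat_set_iff_bounded mem_Collect_eq)
  have "cylinder (map \<omega> [0..<n]) \<subseteq> (\<Pi>\<^sub>E i\<in>UNIV. X i)"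
  proof
    fix \<xi> assume \<xi>: "\<xi> \<in> cylinder (map \<omega> [0..<n])"
    have "\<xi> i \<in> X i" for i
    proof (cases "X i = UNIV")
      case False
      with n have "i < n" by blast
      with \<xi> have "\<xi> i = \<omega> i" by (simp add: cylinder_def)
      with X(1) show ?thesis by (auto simp: PiE_iff)
    qed simp
    then show "\<xi> \<in> (\<Pi>\<^sub>E i\<in>UNIV. X i)" by auto
  qed
  with X(3) show ?thesis
    by (intro exI[of _ "map \<omega> [0..<n]"]) (auto simp: cylinder_def)
qed

text \<open>
  Two cylinders are nested or disjoint; the empty set is added to the generator for the second case.
\<close>

lemma Int_stable_cylinders: "Int_stable (insert {} (range (cylinder :: 'i list \<Rightarrow> _)))"
proof -
  have *: "cylinder v \<inter> cylinder w \<in> insert {} (range cylinder)" if "length v \<le> length w"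
    for v w :: "'i list"
  proof (cases "cylinder v \<inter> cylinder w = {}")
    case False
    then obtain \<xi> where "\<xi> \<in> cylinder v" "\<xi> \<in> cylinder w" by blast
    with that have "cylinder w \<subseteq> cylinder v"
      by (auto simp: cylinder_def)
    then show ?thesis by (auto simp: Int_absorb1)
  qed simp
  show ?thesis
  proof (rule Int_stableI)
    fix a b assume "a \<in> insert {} (range (cylinder :: 'i list \<Rightarrow> _))" "b \<in> insert {} (range (cylinder :: 'i list \<Rightarrow> _))"
    then consider "a = {} \<or> b = {}" | v w where "a = cylinder v" "b = cylinder w" by auto
    then show "a \<inter> b \<in> insert {} (range (cylinder :: 'i list \<Rightarrow> _))"
    proof cases
      case 2 then show ?thesis
        using *[of v w] *[of w v] by (metis Int_commute linear)
    qed auto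
  qed
qed

text \<open>
  There are only countably many words over a finite alphabet, so the union of cylinders that makes
  up an open set is a countable one.
\<close>

lemma sets_borel_sequences:
  "sets (borel :: (nat \<Rightarrow> 'i::{finite,discrete_topology}) measure) =
     sigma_sets UNIV (insert {} (range cylinder))" (is "_ = sigma_sets UNIV ?G")
proof -
  interpret sigma_algebra UNIV "sigma_sets UNIV ?G"
    by (rule sigma_algebra_sigma_sets) simp
  have "U \<in> sigma_sets UNIV ?G" if "open U" for U :: "(nat \<Rightarrow> 'i) set"
  proof -
    have "U = (\<Union>w\<in>{w. cylinder w \<subseteq> U}. cylinder w)"
      using open_contains_cylinder[OF that] by blast
    also have "\<dots> \<in> sigma_sets UNIV ?G"
      by (intro countable_UN'') (auto intro: countable_subset[OF subset_UNIV])
    finally show ?thesis .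
  qed
  then show ?thesis
    unfolding sets_borel by (intro sigma_sets_eqI) (auto intro: open_cylinder)
qed

text \<open>
  The connection to the product sigma-algebra, on which infinite product constructions of measures
  live.
\<close>

lemma sets_borel_sequences_PiM:
  "sets (borel :: (nat \<Rightarrow> 'i::{finite,discrete_topology}) measure) = sets (\<Pi>\<^sub>M i\<in>UNIV. count_space UNIV)"
proof (rule antisym)
  have "cylinder w \<in> sets (\<Pi>\<^sub>M i\<in>UNIV. count_space UNIV)" for w :: "'i list"
  proof -
    have "{\<xi> \<in> space (\<Pi>\<^sub>M i\<in>UNIV. count_space UNIV). \<forall>k\<in>{..<length w}. \<xi> k = w ! k}
        \<in> sets (\<Pi>\<^sub>M i\<in>UNIV. count_space (UNIV :: 'i set))"
      by measurable
    then show ?thesis by (simp add: cylinder_def space_PiM Ball_def)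
  qed
  note * = this
  show "sets (borel :: (nat \<Rightarrow> 'i) measure) \<subseteq> sets (\<Pi>\<^sub>M i\<in>UNIV. count_space (UNIV :: 'i set))"
    unfolding sets_borel_sequences
    by (intro sets.sigma_sets_subset' subsetI)
      (use sets.top[of "\<Pi>\<^sub>M i\<in>(UNIV :: nat set). count_space (UNIV :: 'i set)"] * in \<open>auto simp: space_PiM\<close>)
  have "{\<xi>. \<xi> k \<in> A} \<in> sets borel" for k :: nat and A :: "'i set"
  proof -
    have "open ((\<lambda>\<xi>::nat \<Rightarrow> 'i. \<xi> k) -` A)"
      by (intro open_vimage discrete_topology_class.open_discrete continuous_on_product_coordinates)
    then show ?thesis by (simp add: vimage_def)
  qed
  then show "sets (\<Pi>\<^sub>M i\<in>UNIV. count_space UNIV) \<subseteq> sets (borel :: (nat \<Rightarrow> 'i) measure)"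
    unfolding sets_PiM_single by (intro sets.sigma_sets_subset') auto
qed

text \<open>
  An open set of the product is the countable union, over all words \<open>w\<close>, of the largest open
  rectangles over \<open>cylinder w\<close> inside it.
\<close>

lemma borel_prod_sequences:
  "sets (borel \<Otimes>\<^sub>M borel) =
     sets (borel :: ('a::topological_space \<times> (nat \<Rightarrow> 'i::{finite,discrete_topology})) measure)"
proof (rule antisym)
  have "U \<in> sets (borel \<Otimes>\<^sub>M borel)" if "open U" for U :: "('a \<times> (nat \<Rightarrow> 'i)) set"
  proof -
    define V where "V w = \<Union>{V. open V \<and> V \<times> cylinder w \<subseteq> U}" for w
    have "open (V w)" for w
      unfolding V_def by (rule open_Union) blast
    then have "(\<Union>w. V w \<times> cylinder w) \<in> sets (borel \<Otimes>\<^sub>M borel)"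
      by (intro sets.countable_UN'') (simp_all add: open_cylinder)
    also have "(\<Union>w. V w \<times> cylinder w) = U"
    proof (intro equalityI subsetI)
      fix z assume "z \<in> U"
      with \<open>open U\<close> obtain D W where DW: "open D" "open W" "z \<in> D \<times> W" "D \<times> W \<subseteq> U"
        by (rule open_prod_elim)
      then obtain w where "snd z \<in> cylinder w" "cylinder w \<subseteq> W"
        using open_contains_cylinder by (metis mem_Times_iff)
      moreover from this(2) DW have "fst z \<in> V w"
        unfolding V_def by (intro UnionI[of D]) auto
      ultimately show "z \<in> (\<Union>w. V w \<times> cylinder w)"
        by (auto simp: mem_Times_iff)
    qed (auto simp: V_def)
    finally show ?thesis .
  qed
  then show "sets (borel :: ('a \<times> (nat \<Rightarrow> 'i)) measure) \<subseteq> sets (borel \<Otimes>\<^sub>M borel)"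
    unfolding sets_borel[where 'a="'a \<times> (nat \<Rightarrow> 'i)"]
    by (intro sets.sigma_sets_subset' subsetI)
      (use sets.top[of "(borel :: 'a measure) \<Otimes>\<^sub>M (borel :: (nat \<Rightarrow> 'i) measure)"]
        in \<open>auto simp: space_pair_measure\<close>)
  have *: "fst \<in> (borel :: ('a \<times> (nat \<Rightarrow> 'i)) measure) \<rightarrow>\<^sub>M borel"
    "snd \<in> (borel :: ('a \<times> (nat \<Rightarrow> 'i)) measure) \<rightarrow>\<^sub>M borel"
    by (auto intro!: borel_measurable_continuous_onI continuous_on_fst continuous_on_snd continuous_on_id)
  show "sets (borel \<Otimes>\<^sub>M borel) \<subseteq> sets (borel :: ('a \<times> (nat \<Rightarrow> 'i)) measure)"
  proof (rule sets_pair_in_sets)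
    fix D :: "'a set" and C :: "(nat \<Rightarrow> 'i) set"
    assume "D \<in> sets borel" "C \<in> sets borel"
    then have "fst -` D \<inter> snd -` C \<in> sets (borel :: ('a \<times> (nat \<Rightarrow> 'i)) measure)"
      using measurable_sets[OF *(1)] measurable_sets[OF *(2)] by (intro sets.Int) simp_all
    also have "fst -` D \<inter> snd -` C = D \<times> C" by auto
    finally show "D \<times> C \<in> sets borel" .
  qed
qed

text \<open>
  Rectangles over cylinders generate the product sigma-algebra; restricted to such a set, the
  sequence coordinate is constrained in finitely many letters only.
\<close>

lemma sets_pair_cylinders:
  "sets ((borel :: 'a::topological_space measure) \<Otimes>\<^sub>M (borel :: (nat \<Rightarrow> 'i::{finite,discrete_topology}) measure)) =
     sigma_sets UNIV {D \<times> C | D C. D \<in> sets borel \<and> C \<in> insert {} (range cylinder)}"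
proof -
  have "sets ((borel :: 'a measure) \<Otimes>\<^sub>M (borel :: (nat \<Rightarrow> 'i) measure)) =
     sets (sigma UNIV (sets (borel::'a measure)) \<Otimes>\<^sub>M sigma UNIV (insert {} (range (cylinder :: 'i list \<Rightarrow> _))))"
    by (intro sets_pair_measure_cong)
      (simp_all add: sets_borel_sequences sets_measure_of sets.sigma_sets_eq[of borel, simplified])
  also have "\<dots> = sets (sigma (UNIV \<times> UNIV) {D \<times> C | D C. D \<in> sets (borel::'a measure) \<and> C \<in> insert {} (range (cylinder :: 'i list \<Rightarrow> _))})"
    by (rule arg_cong[where f=sets], subst sigma_prod)
       (auto intro!: exI[of _ "{UNIV}"] image_eqI[of _ _ "[]"] simp: cylinder_Nil)
  also have "\<dots> = sigma_sets UNIV {D \<times> C | D C. D \<in> sets borel \<and> C \<in> insert {} (range cylinder)}"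
    by (subst sets_measure_of) auto
  finally show ?thesis .
qed

lemma measurable_tl_sequence [measurable]:
  "(\<lambda>\<omega> n. \<omega> (Suc n)) \<in> borel \<rightarrow>\<^sub>M (borel :: (nat \<Rightarrow> 'i::{finite,discrete_topology}) measure)"
proof (rule measurable_sigma_sets[OF sets_borel_sequences])
  fix C :: "(nat \<Rightarrow> 'i) set" assume "C \<in> insert {} (range cylinder)"
  then consider "C = {}" | w where "C = cylinder w" by auto
  then show "(\<lambda>\<omega> n. \<omega> (Suc n)) -` C \<inter> space borel \<in> sets borel"
  proof cases
    case 2
    then have "(\<lambda>\<omega> n. \<omega> (Suc n)) -` C = (\<Union>j. cylinder (j # w))"
      by (auto simp: cylinder_Cons)
    then show ?thesis by (auto intro!: borel_open open_UN open_cylinder)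
  qed simp
qed auto

lemma measurable_Cons_sequence [measurable]:
  "case_nat i \<in> borel \<rightarrow>\<^sub>M (borel :: (nat \<Rightarrow> 'i::{finite,discrete_topology}) measure)"
proof (rule measurable_sigma_sets[OF sets_borel_sequences])
  fix C :: "(nat \<Rightarrow> 'i) set" assume "C \<in> insert {} (range cylinder)"
  then consider "C = {} \<or> C = UNIV" | j w where "C = cylinder (j # w)"
    by (metis cylinder_Nil insert_iff neq_Nil_conv rangeE)
  then show "case_nat i -` C \<inter> space borel \<in> sets borel"
  proof cases
    case 2
    then have "case_nat i -` C = (if i = j then cylinder w else {})"
      by (auto simp: cylinder_Cons)
    then show ?thesis by (auto intro!: borel_open open_cylinder)
  qed auto
qed auto

section \<open>The path measures\<close>

lemma measure_eqI_cylinders: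
  fixes M N :: "(nat \<Rightarrow> 'i::{finite,discrete_topology}) measure"
  assumes "prob_space M" "prob_space N" and [simp]: "sets M = sets borel" "sets N = sets borel"
    and eq: "\<And>w. measure M (cylinder w) = measure N (cylinder w)"
  shows "M = N"
proof (rule measure_eqI_generator_eq[OF Int_stable_cylinders])
  interpret M: prob_space M by fact
  interpret N: prob_space N by fact
  show "emeasure M X = emeasure N X" if "X \<in> insert {} (range cylinder)" for X
    using that eq by (auto simp: M.emeasure_eq_measure N.emeasure_eq_measure)
  show "range (\<lambda>_::nat. UNIV) \<subseteq> insert {} (range (cylinder :: 'i list \<Rightarrow> _))"
    by (auto intro!: image_eqI[of _ _ "[]"] simp: cylinder_Nil)
  show "emeasure M UNIV \<noteq> \<infinity>"
    by simp
qed (simp_all add: sets_borel_sequences)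

locale ifs_system =
  fixes S :: "'i::{finite,discrete_topology} \<Rightarrow> 'a::topological_space \<Rightarrow> 'a" and p :: "'i \<Rightarrow> 'a \<Rightarrow> real"
  assumes measurable_ifs: "measurable_ifs S p"
begin

lemma measurable_map [measurable]: "S i \<in> borel \<rightarrow>\<^sub>M borel"
  and measurable_weight [measurable]: "p i \<in> borel_measurable borel"
  and weight_nonneg [simp]: "0 \<le> p i x"
  and sum_weights: "(\<Sum>i\<in>UNIV. p i x) = 1"
  using measurable_ifs by (auto simp: measurable_ifs_def)

lemma word_weight_Nil [simp]: "word_weight S p [] x = 1"
  by (simp add: word_weight_def)

lemma word_weight_Cons: "word_weight S p (j # w) x = p j x * word_weight S p w (S j x)"
  by (simp add: word_weight_def word_map_def prod.lessThan_Suc_shift del: prod.lessThan_Suc)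

lemma word_weight_snoc: "word_weight S p (w @ [j]) x = word_weight S p w x * p j (word_map S w x)"
  by (simp add: word_weight_def nth_append)

lemma word_weight_nonneg [simp]: "0 \<le> word_weight S p w x"
  by (simp add: word_weight_def prod_nonneg)

lemma measurable_word_weight [measurable]: "word_weight S p w \<in> borel_measurable borel"
  by (induction w) (simp_all add: word_weight_Cons[abs_def] word_weight_def[of S p "[]", abs_def])

definition letter_law :: "'a \<Rightarrow> 'i measure" where
  "letter_law x = point_measure UNIV (\<lambda>i. ennreal (p i x))"

lemma sets_letter_law [simp]: "sets (letter_law x) = UNIV"
  and space_letter_law [simp]: "space (letter_law x) = UNIV"
  by (simp_all add: letter_law_def sets_point_measure space_point_measure)

lemma prob_space_letter_law: "prob_space (letter_law x)"
  by (rule prob_spaceI) (simp add: letter_law_def space_point_measure emeasure_point_measure_finite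
      sum_weights flip: ennreal_1)

text \<open>
  The letter after a finite word \<open>v\<close> has the law \<open>letter_law\<close> at the point reached along \<open>v\<close>. These
  conditional laws depend measurably on \<open>v\<close>, as they are functions on a finite discrete space, and
  the theorem of Ionescu-Tulcea produces a measure on infinite sequences from them.
\<close>

lemma path_measure_exists:
  "\<exists>M. prob_space M \<and> sets M = sets borel \<and> (\<forall>w. measure M (cylinder w) = word_weight S p w x)"
proof -
  define P where "P n \<omega> = letter_law (word_map S (map \<omega> [0..<n]) x)" for n and \<omega> :: "nat \<Rightarrow> 'i"
  let ?M = "\<lambda>_::nat. count_space (UNIV::'i set)"
  have PiM_eq: "PiM J ?M = count_space (PiE J (\<lambda>_. UNIV))" if "finite J" for J
    using that by (intro count_space_PiM_finite) auto
  interpret Ionescu_Tulcea P ?M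
  proof (rule Ionescu_Tulcea.intro)
    show "P n \<in> measurable (PiM {0..<n} ?M) (subprob_algebra (?M n))" for n
      by (auto simp: PiM_eq P_def space_subprob_algebra prob_space_letter_law prob_space_imp_subprob_space)
  qed (simp add: P_def prob_space_letter_law)
  \<comment> \<open>\<open>C 0 n\<close> is the joint law of the first \<open>n\<close> letters; its mass at a word is the weight of that word.\<close>
  have C: "emeasure (C 0 (length w) (\<lambda>_. undefined)) {restrict ((!) w) {0..<length w}} = ennreal (word_weight S p w x)" for w
  proof (induction w rule: rev_induct)
    case Nil
    show ?case by (auto simp: PiM_eq)
  next
    case (snoc j w)
    let ?n = "length w"
    let ?r = "\<lambda>w. restrict ((!) w) {0..<length w}"
    have u: "(\<lambda>_. undefined) \<in> space (PiM {0..<0} ?M)"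
      by (simp add: space_PiM)
    have "emeasure (C 0 (Suc ?n) (\<lambda>_. undefined)) {?r (w @ [j])} =
        (\<integral>\<^sup>+\<omega>. emeasure (eP ?n \<omega>) {?r (w @ [j])} \<partial>C 0 ?n (\<lambda>_. undefined))"
    proof -
      have "eP ?n \<in> C 0 ?n (\<lambda>_. undefined) \<rightarrow>\<^sub>M subprob_algebra (PiM {0..<Suc ?n} ?M)"
        using measurable_eP[of ?n] sets_C[OF u, of ?n] by (simp cong: measurable_cong_sets)
      moreover have "space (C 0 ?n (\<lambda>_. undefined)) \<noteq> {}"
        using space_C[OF u, of ?n] by (simp add: space_PiM PiE_eq_empty_iff)
      moreover have "{?r (w @ [j])} \<in> sets (PiM {0..<Suc ?n} ?M)"
        by (auto simp: PiM_eq)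
      ultimately show ?thesis
        by (simp add: emeasure_bind)
    qed
    also have "\<dots> = (\<integral>\<^sup>+\<omega>. ennreal (p j (word_map S w x)) * indicator {?r w} \<omega> \<partial>C 0 ?n (\<lambda>_. undefined))"
    proof (rule nn_integral_cong)
      fix \<omega> assume "\<omega> \<in> space (C 0 ?n (\<lambda>_. undefined))"
      then have \<omega>: "\<omega> \<in> PiE {0..<?n} (\<lambda>_. UNIV)"
        using space_C[OF u, of ?n] by (simp add: PiM_eq)
      have "emeasure (eP ?n \<omega>) {?r (w @ [j])} = emeasure (P ?n \<omega>) ((\<lambda>s. fun_upd \<omega> ?n s) -` {?r (w @ [j])})"
        using \<omega> by (subst emeasure_eP) (auto simp: PiM_eq)
      also have "\<dots> = ennreal (p j (word_map S w x)) * indicator {?r w} \<omega>"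
      proof (cases "\<omega> = ?r w")
        case True
        have "(\<lambda>s. fun_upd \<omega> ?n s) -` {?r (w @ [j])} = {j}"
        proof -
          have "s = j" if "fun_upd \<omega> ?n s = ?r (w @ [j])" for s
            using fun_cong[OF that, of ?n] by simp
          moreover have "fun_upd \<omega> ?n j = ?r (w @ [j])"
            by (auto simp: True fun_eq_iff nth_append restrict_def)
          ultimately show ?thesis by auto
        qed
        moreover have "map \<omega> [0..<?n] = w"
          unfolding True by (intro nth_equalityI) simp_all
        ultimately have "emeasure (P ?n \<omega>) (fun_upd \<omega> ?n -` {?r (w @ [j])}) = ennreal (p j (word_map S w x))"
          by (simp only: P_def letter_law_def) (simp add: emeasure_point_measure_finite)
        moreover have "indicator {?r w} \<omega> = (1::ennreal)"
          using True by (simp only: indicator_simps singletonI)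
        ultimately show ?thesis
          by (simp only: mult_1_right)
      next
        case False
        have "(\<lambda>s. fun_upd \<omega> ?n s) -` {?r (w @ [j])} = {}"
        proof (rule ccontr)
          assume "\<not> ?thesis"
          then obtain s where s: "fun_upd \<omega> ?n s = ?r (w @ [j])" by auto
          have "\<omega> k = ?r w k" for k
          proof (cases "k < ?n")
            case True with fun_cong[OF s, of k] show ?thesis by (simp add: nth_append)
          next
            case False with \<omega> show ?thesis by (auto simp: PiE_def extensional_def)
          qed
          with \<open>\<omega> \<noteq> ?r w\<close> show False by blast
        qed
        with False show ?thesis by simp
      qed
      finally show "emeasure (eP ?n \<omega>) {?r (w @ [j])} = ennreal (p j (word_map S w x)) * indicator {?r w} \<omega>" .
    qed
    also have "\<dots> = ennreal (word_weight S p (w @ [j]) x)"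
      using sets_C[OF u, of ?n]
      by (subst nn_integral_cmult_indicator)
        (auto simp: PiM_eq snoc.IH word_weight_snoc ennreal_mult mult.commute)
    finally show ?case by (simp only: length_append_singleton)
  qed
  have "measure PF.lim (cylinder w) = word_weight S p w x" for w
  proof -
    let ?X = "{restrict ((!) w) {0..<length w}}"
    have X: "?X \<in> sets (PiM {0..<length w} ?M)"
      by (auto simp: PiM_eq)
    have "cylinder w = PF.emb UNIV {0..<length w} ?X"
    proof -
      have "restrict \<xi> {0..<length w} = restrict ((!) w) {0..<length w} \<longleftrightarrow> (\<forall>k<length w. \<xi> k = w ! k)" for \<xi>
        by (metis atLeastLessThan_iff le0 restrict_apply' restrict_ext)
      then show ?thesis by (simp add: cylinder_def prod_emb_def vimage_def)
    qed
    moreover have "PF.emb {0..<length w} {0..<length w} ?X = ?X"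
      by (rule prod_emb_id) auto
    ultimately have "emeasure PF.lim (cylinder w) = ennreal (word_weight S p w x)"
      using X by (simp add: lim emeasure_CI[of _ "length w"] C)
    then show ?thesis by (simp add: measure_def)
  qed
  moreover have "prob_space PF.lim"
  proof (rule prob_spaceI)
    have "emeasure PF.lim (PF.emb UNIV {} {\<lambda>_. undefined}) = emeasure (CI {}) {\<lambda>_. undefined}"
      by (rule lim) (auto simp: PiM_eq)
    also have "PF.emb UNIV {} {\<lambda>_. undefined} = space PF.lim"
      by (auto simp: prod_emb_def space_PiM)
    also have "emeasure (CI {}) {\<lambda>_. undefined} = 1"
      using emeasure_CI[of "{}" 0 "{\<lambda>_. undefined}"] C[of "[]"] by (simp add: PiM_eq restrict_def prod_emb_def)
    finally show "emeasure PF.lim (space PF.lim) = 1" .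
  qed
  moreover have "sets PF.lim = sets borel"
    by (simp add: sets_borel_sequences_PiM)
  ultimately show ?thesis by blast
qed

text \<open>
  Existence and uniqueness make the definite description in \<open>path_measure_def\<close> meaningful.
\<close>

lemma path_measure:
  shows prob_space_path_measure: "prob_space (path_measure S p x)"
    and sets_path_measure [simp]: "sets (path_measure S p x) = sets borel"
    and measure_path_measure_cylinder: "measure (path_measure S p x) (cylinder w) = word_weight S p w x"
proof -
  have "\<exists>!M. prob_space M \<and> sets M = sets borel \<and> (\<forall>w. measure M (cylinder w) = word_weight S p w x)"
    by (rule ex_ex1I[OF path_measure_exists]) (auto intro: measure_eqI_cylinders)
  from theI'[OF this] show "prob_space (path_measure S p x)"
    "sets (path_measure S p x) = sets borel"
    "measure (path_measure S p x) (cylinder w) = word_weight S p w x"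
    unfolding path_measure_def by blast+
qed

lemma space_path_measure [simp]: "space (path_measure S p x) = UNIV"
  using sets_eq_imp_space_eq[OF sets_path_measure] by simp

lemma emeasure_path_measure_UNIV [simp]: "emeasure (path_measure S p x) UNIV = 1"
  using prob_space.emeasure_space_1[OF prob_space_path_measure] by simp

lemma emeasure_path_measure_cylinder:
  "emeasure (path_measure S p x) (cylinder w) = ennreal (word_weight S p w x)"
  by (simp add: finite_measure.emeasure_eq_measure prob_space.finite_measure prob_space_path_measure
      measure_path_measure_cylinder)

lemma measurable_path_measure [measurable]: "path_measure S p \<in> borel \<rightarrow>\<^sub>M prob_algebra borel"
proof (rule measurable_prob_algebra_generated[OF sets_borel_sequences Int_stable_cylinders])
  show "(\<lambda>x. emeasure (path_measure S p x) A) \<in> borel_measurable borel"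
    if "A \<in> insert {} (range cylinder)" for A
    using that by (auto simp: emeasure_path_measure_cylinder)
qed (auto simp: prob_space_path_measure)

text \<open>
  The first-step decomposition. Both sides integrate against probability measures, and
  \<open>word_weight_Cons\<close> says that these measures agree on cylinders.
\<close>

lemma nn_integral_path_measure:
  assumes [measurable]: "F \<in> borel_measurable borel"
  shows "(\<integral>\<^sup>+\<omega>. F \<omega> \<partial>path_measure S p x) =
    (\<Sum>i\<in>UNIV. ennreal (p i x) * (\<integral>\<^sup>+\<omega>. F (case_nat i \<omega>) \<partial>path_measure S p (S i x)))"
proof -
  \<comment> \<open>The right-hand side as a measure: draw the first letter, then prepend it to a path from its image.\<close>
  define K where "K i = distr (path_measure S p (S i x)) borel (case_nat i)" for i
  have K: "K \<in> letter_law x \<rightarrow>\<^sub>M prob_algebra borel"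
  proof -
    have "prob_space (K i)" for i
      unfolding K_def
      by (intro prob_space.prob_space_distr prob_space_path_measure)
        (simp add: measurable_cong_sets[OF sets_path_measure refl])
    then show ?thesis
      by (auto simp: measurable_def space_prob_algebra K_def)
  qed
  have L: "letter_law x \<in> space (prob_algebra (letter_law x))"
    by (simp add: space_prob_algebra prob_space_letter_law)
  have int: "(\<integral>\<^sup>+\<omega>. G \<omega> \<partial>(letter_law x \<bind> K)) =
      (\<Sum>i\<in>UNIV. ennreal (p i x) * (\<integral>\<^sup>+\<omega>. G (case_nat i \<omega>) \<partial>path_measure S p (S i x)))"
    if [measurable]: "G \<in> borel_measurable borel" for G
    by (subst nn_integral_bind[OF that measurable_prob_algebraD[OF K]])
       (simp add: letter_law_def nn_integral_point_measure_finite K_def nn_integral_distr 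
         measurable_cong_sets[OF sets_path_measure refl])
  have "path_measure S p x = letter_law x \<bind> K"
  proof (rule measure_eqI_cylinders)
    show "prob_space (letter_law x \<bind> K)" by (rule prob_space_bind'[OF L K])
    then interpret B: prob_space "letter_law x \<bind> K" .
    show sB: "sets (letter_law x \<bind> K) = sets borel" by (rule sets_bind'[OF L K])
    show "measure (path_measure S p x) (cylinder w) = measure (letter_law x \<bind> K) (cylinder w)" for w
    proof -
      have "emeasure (letter_law x \<bind> K) (cylinder w) = (\<integral>\<^sup>+\<omega>. indicator (cylinder w) \<omega> \<partial>(letter_law x \<bind> K))"
        using sB by (simp add: open_cylinder)
      also have "\<dots> = ennreal (word_weight S p w x)"
      proof (cases w)
        case Nil then show ?thesis using B.emeasure_space_1 sets_eq_imp_space_eq[OF sB] by (simp add: cylinder_Nil)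
      next
        case (Cons j v)
        have *: "ennreal (p i x) * (\<integral>\<^sup>+\<omega>. indicator (cylinder w) (case_nat i \<omega>) \<partial>path_measure S p (S i x)) =
           (if i = j then ennreal (word_weight S p w x) else 0)" for i
        proof -
          have "indicator (cylinder w) (case_nat i \<omega>) = (if i = j then indicator (cylinder v) \<omega> else 0 :: ennreal)" for \<omega>
            by (auto simp: Cons cylinder_Cons indicator_def)
          then show ?thesis
            by (simp add: open_cylinder emeasure_path_measure_cylinder Cons word_weight_Cons ennreal_mult)
        qed
        have "(\<integral>\<^sup>+\<omega>. indicator (cylinder w) \<omega> \<partial>(letter_law x \<bind> K)) =
            (\<Sum>i\<in>UNIV. if i = j then ennreal (word_weight S p w x) else 0)"
          by (subst int) (simp_all add: open_cylinder *)
        then show ?thesis by simp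
      qed
      finally have "measure (letter_law x \<bind> K) (cylinder w) = word_weight S p w x"
        by (simp add: measure_def)
      then show ?thesis
        by (simp add: measure_path_measure_cylinder)
    qed
  qed (simp_all add: prob_space_path_measure)
  then show ?thesis using int[OF assms] by simp
qed

end

section \<open>Invariant measures and limits of measures\<close>

lemma funpow_mem_iff:
  assumes "\<And>z. T z \<in> A \<longleftrightarrow> z \<in> A"
  shows "(T ^^ n) z \<in> A \<longleftrightarrow> z \<in> A"
  by (induction n) (simp_all add: assms)

text \<open>
  The difference \<open>d = M - N\<close> attains its maximum on a set \<open>Y\<close>, by the Hahn decomposition. The sets
  on which the maximum is attained are closed under preimages, unions and monotone limits, so the
  upper limit of the sets \<open>(T ^^ n) -` Y\<close> is one of them. It is strictly invariant, hence \<open>d\<close> vanishes there,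
  the maximum is 0, and passing to complements gives \<open>d = 0\<close>.
\<close>

lemma invariant_measures_eqI:
  assumes "prob_space M" "prob_space N" and sets_N: "sets N = sets M"
    and T: "T \<in> M \<rightarrow>\<^sub>M M" and inv_M: "distr M M T = M" and inv_N: "distr N N T = N"
    and agree: "\<And>A. A \<in> sets M \<Longrightarrow> T -` A \<inter> space M = A \<Longrightarrow> measure M A = measure N A"
  shows "M = N"
proof -
  interpret M: prob_space M by fact
  interpret N: prob_space N by fact
  have space_N: "space N = space M"
    using sets_N by (rule sets_eq_imp_space_eq)
  have T_N: "T \<in> N \<rightarrow>\<^sub>M N"
    using T by (simp add: measurable_cong_sets[OF sets_N sets_N])
  define d where "d E = measure M E - measure N E" for E
  from finite_unsigned_Hahn_decomposition[OF M.finite_measure_axioms N.finite_measure_axioms sets_N]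
  obtain Y where Y: "Y \<in> sets M"
    and pos: "\<forall>X\<in>sets M. X \<subseteq> Y \<longrightarrow> emeasure N X \<le> emeasure M X"
    and neg: "\<forall>X\<in>sets M. X \<inter> Y = {} \<longrightarrow> emeasure M X \<le> emeasure N X"
    by (elim bexE conjE)
  have pos': "0 \<le> d X" if "X \<in> sets M" "X \<subseteq> Y" for X
    using pos that by (simp add: d_def M.emeasure_eq_measure N.emeasure_eq_measure)
  have neg': "d X \<le> 0" if "X \<in> sets M" "X \<inter> Y = {}" for X
    using neg that by (simp add: d_def M.emeasure_eq_measure N.emeasure_eq_measure)
  have d_Diff: "d (A - B) = d A - d (A \<inter> B)" if "A \<in> sets M" "B \<in> sets M" for A B
    using that sets_N by (simp add: d_def M.finite_measure_Diff' N.finite_measure_Diff')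
  have d_Un: "d (A \<union> B) = d A + d (B - A)" if "A \<in> sets M" "B \<in> sets M" for A B
    using that sets_N by (simp add: d_def M.finite_measure_Union' N.finite_measure_Union')
  have d_le: "d X \<le> d Y" if X: "X \<in> sets M" for X
  proof -
    have "d (X - Y) \<le> 0" "0 \<le> d (Y - X)"
      using X Y by (auto intro: pos' neg')
    with d_Diff[OF X Y] d_Diff[OF Y X] show ?thesis
      by (simp add: Int_commute)
  qed
  \<comment> \<open>Since \<open>d (A \<union> B) + d (A \<inter> B) = d A + d B\<close>, neither term on the left can stay below the maximum.\<close>
  have d_max_Un: "d (A \<union> B) = d Y" if "A \<in> sets M" "B \<in> sets M" "d A = d Y" "d B = d Y" for A B
  proof (rule antisym)
    show "d (A \<union> B) \<le> d Y" using that by (intro d_le) auto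
    have "d (A \<inter> B) \<le> d Y" using that by (intro d_le) auto
    with that d_Un[of A B] d_Diff[of B A] show "d Y \<le> d (A \<union> B)"
      by (simp add: Int_commute)
  qed
  define Z where "Z k = (T ^^ k) -` Y \<inter> space M" for k
  have Z_Suc: "T -` Z k \<inter> space M = Z (Suc k)" for k
    using measurable_space[OF T] by (auto simp: Z_def funpow_swap1)
  have d_vimage: "d (T -` X \<inter> space M) = d X" if "X \<in> sets M" for X
  proof -
    have "measure M (T -` X \<inter> space M) = measure M X"
      using measure_distr[OF T that] by (simp add: inv_M)
    moreover have "measure N (T -` X \<inter> space N) = measure N X"
      using measure_distr[OF T_N, of X] that by (simp add: inv_N sets_N)
    ultimately show ?thesis
      by (simp add: d_def space_N)
  qed
  have Z: "Z k \<in> sets M \<and> d (Z k) = d Y" for k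
  proof (induction k)
    case 0
    then show ?case using Y sets.sets_into_space[OF Y] by (simp add: Z_def Int_absorb2)
  next
    case (Suc k)
    then show ?case using measurable_sets[OF T] d_vimage by (simp flip: Z_Suc)
  qed
  define U where "U n = (\<Union>k. Z (n + k))" for n
  have U_sets: "U n \<in> sets M" for n
    using Z by (auto simp: U_def)
  have d_U: "d (U n) = d Y" for n
  proof -
    define V where "V m = (\<Union>k<Suc m. Z (n + k))" for m
    have V: "V m \<in> sets M \<and> d (V m) = d Y" for m
    proof (induction m)
      case (Suc m)
      have "V (Suc m) = V m \<union> Z (n + Suc m)"
        by (auto simp: V_def lessThan_Suc)
      with Suc Z d_max_Un show ?case by auto
    qed (simp add: V_def Z lessThan_Suc)
    have inc: "incseq V" by (auto simp: V_def incseq_def intro: less_le_trans)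
    have "range V \<subseteq> sets M" "range V \<subseteq> sets N" using V sets_N by auto
    then have "(\<lambda>m. d (V m)) \<longlonglongrightarrow> d (\<Union>m. V m)"
      unfolding d_def by (intro tendsto_diff M.finite_Lim_measure_incseq N.finite_Lim_measure_incseq inc)
    moreover have "(\<Union>m. V m) = U n" by (auto simp: V_def U_def)
    ultimately show ?thesis using V by (simp add: LIMSEQ_const_iff)
  qed
  \<comment> \<open>The upper limit of the sets \<open>Z k\<close>; taking preimages only shifts the sequence, so it is invariant.\<close>
  define F where "F = (\<Inter>n. U n)"
  have U_Suc: "U (Suc n) \<subseteq> U n" for n
  proof
    fix x assume "x \<in> U (Suc n)"
    then obtain k where "x \<in> Z (n + Suc k)" by (auto simp: U_def)
    then show "x \<in> U n" unfolding U_def by blast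
  qed
  then have dec: "decseq U" by (intro decseq_SucI)
  have "range U \<subseteq> sets M" "range U \<subseteq> sets N" using U_sets sets_N by auto
  then have "(\<lambda>n. d (U n)) \<longlonglongrightarrow> d F"
    unfolding d_def F_def by (intro tendsto_diff M.finite_Lim_measure_decseq N.finite_Lim_measure_decseq dec)
  then have "d F = d Y" by (simp add: d_U LIMSEQ_const_iff)
  moreover have "T -` F \<inter> space M = F"
  proof -
    have vimage_U: "T -` U n \<inter> space M = U (Suc n)" for n
    proof -
      have "T -` U n \<inter> space M = (\<Union>k. T -` Z (n + k) \<inter> space M)"
        unfolding U_def by blast
      then show ?thesis unfolding Z_Suc U_def by simp
    qed
    have "T -` F \<inter> space M = (\<Inter>n. T -` U n \<inter> space M)"
      unfolding F_def by blast
    also have "\<dots> = (\<Inter>n. U (Suc n))"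
      unfolding vimage_U ..
    also have "\<dots> = F"
      unfolding F_def using U_Suc by (intro equalityI INT_greatest) blast+
    finally show ?thesis .
  qed
  moreover have "F \<in> sets M" using U_sets by (auto simp: F_def)
  ultimately have dY: "d Y = 0" using agree by (simp add: d_def)
  show "M = N"
  proof (rule measure_eqI)
    fix A assume A: "A \<in> sets M"
    then have "d (space M - A) \<le> 0" "d A \<le> 0"
      using d_le[of A] d_le[of "space M - A"] dY by auto
    moreover have "d (space M - A) = - d A"
      using A sets_N N.prob_compl[of A] by (simp add: d_def M.prob_compl space_N)
    ultimately have "d A = 0" by simp
    then show "emeasure M A = emeasure N A"
      by (simp add: d_def M.emeasure_eq_measure N.emeasure_eq_measure)
  qed (simp add: sets_N)
qed

text \<open>
  A Dynkin system argument. The common bound \<open>N\<close> dominates the series that arise from disjoint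
  unions, so that limit and sum can be interchanged.
\<close>

lemma tendsto_measure_generator:
  fixes M :: "nat \<Rightarrow> 'b measure"
  assumes G: "Int_stable G" "G \<subseteq> Pow \<Omega>"
    and sets_M: "\<And>n. sets (M n) = sigma_sets \<Omega> G" and sets_L: "sets L = sigma_sets \<Omega> G"
    and sets_N: "sets N = sigma_sets \<Omega> G"
    and fin: "\<And>n. finite_measure (M n)" "finite_measure L" "finite_measure N"
    and bound: "\<And>n A. A \<in> sigma_sets \<Omega> G \<Longrightarrow> measure (M n) A \<le> measure N A"
    and lim_G: "\<And>A. A \<in> G \<Longrightarrow> (\<lambda>n. measure (M n) A) \<longlonglongrightarrow> measure L A"
    and lim_\<Omega>: "(\<lambda>n. measure (M n) \<Omega>) \<longlonglongrightarrow> measure L \<Omega>"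
    and A: "A \<in> sigma_sets \<Omega> G"
  shows "(\<lambda>n. measure (M n) A) \<longlonglongrightarrow> measure L A"
  using G A
proof (induction rule: sigma_sets_induct_disjoint)
  case (basic A)
  then show ?case by (rule lim_G)
next
  case (compl A)
  have "space K = \<Omega>" if "sets K = sigma_sets \<Omega> G" for K
    using that G(2) sets_eq_imp_space_eq[of K "sigma \<Omega> G"] by simp
  note space = this[OF sets_M] this[OF sets_L]
  have "measure (M n) (\<Omega> - A) = measure (M n) \<Omega> - measure (M n) A" for n
    using finite_measure.finite_measure_compl[OF fin(1), of A n] compl by (simp add: sets_M space)
  moreover have "measure L (\<Omega> - A) = measure L \<Omega> - measure L A"
    using finite_measure.finite_measure_compl[OF fin(2), of A] compl by (simp add: sets_L space)
  ultimately show ?case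
    using tendsto_diff[OF lim_\<Omega> compl(2)] by simp
next
  case (union A)
  have sums: "(\<lambda>k. measure K (A k)) sums measure K (\<Union>k. A k)"
    if "finite_measure K" "sets K = sigma_sets \<Omega> G" for K
    using finite_measure.finite_measure_UNION[OF that(1)] union that(2) by auto
  have "(\<lambda>n. \<Sum>k. measure (M n) (A k)) \<longlonglongrightarrow> (\<Sum>k. measure L (A k))"
  proof (rule tannerys_theorem[THEN conjunct2, THEN conjunct2])
    show "summable (\<lambda>k. measure N (A k))"
      using sums[OF fin(3) sets_N] by (rule sums_summable)
    show "\<forall>\<^sub>F (k, n) in at_top \<times>\<^sub>F sequentially. norm (measure (M n) (A k)) \<le> measure N (A k)"
    proof -
      have "A k \<in> sigma_sets \<Omega> G" for k using union(2) by auto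
      with bound show ?thesis by (intro always_eventually) auto
    qed
  qed (use union in auto)
  then show ?case
    using sums_unique[OF sums[OF fin(1) sets_M]] sums_unique[OF sums[OF fin(2) sets_L]] by simp
qed simp

section \<open>The skew product and the skew measure\<close>

text \<open>
  Set functions given by a formula are recognised as a known measure, so that their countable
  additivity needs no separate proof.
\<close>

lemma measure_of_eq_measureI:
  assumes "sets N = sets borel"
    and "\<And>A. A \<in> sets borel \<Longrightarrow> emeasure N A = f A"
  shows "measure_of UNIV (sets borel) f = N"
proof -
  have "measure_of UNIV (sets borel) f = measure_of (space N) (sets N) (emeasure N)"
    using assms sets_eq_imp_space_eq[OF assms(1)]
    by (auto intro!: measure_of_eq simp: sets.sigma_sets_eq[of borel, simplified])
  then show ?thesis by (simp add: measure_of_of_measure)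
qed

context ifs_system
begin

abbreviation product_space :: "('a \<times> (nat \<Rightarrow> 'i)) measure" where
  "product_space \<equiv> borel \<Otimes>\<^sub>M borel"

lemma measurable_head [measurable]: "(\<lambda>\<omega>. \<omega> 0) \<in> (borel :: (nat \<Rightarrow> 'i) measure) \<rightarrow>\<^sub>M count_space UNIV"
  by (simp add: measurable_cong_sets[OF sets_borel_sequences_PiM refl])

lemma measurable_skew_product [measurable]: "skew_product S \<in> product_space \<rightarrow>\<^sub>M product_space"
proof -
  have "(\<lambda>z. S (snd z 0) (fst z)) \<in> product_space \<rightarrow>\<^sub>M borel"
    by (rule measurable_compose_countable[where f="\<lambda>i z. S i (fst z)" and g="\<lambda>z. snd z 0"]) measurable
  then have "(\<lambda>z. (S (snd z 0) (fst z), (\<lambda>n. snd z (Suc n)))) \<in> product_space \<rightarrow>\<^sub>M product_space"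
    by measurable
  then show ?thesis
    by (simp add: skew_product_def case_prod_beta')
qed

lemma measurable_skew_power [measurable]: "skew_product S ^^ n \<in> product_space \<rightarrow>\<^sub>M product_space"
  by (rule measurable_compose_n) (rule measurable_skew_product)

lemma skew_product_Cons [simp]: "skew_product S (x, case_nat i \<omega>) = (S i x, \<omega>)"
  by (simp add: skew_product_def)

lemma measurable_path_integral [measurable]:
  assumes F: "F \<in> borel_measurable product_space"
  shows "(\<lambda>x. \<integral>\<^sup>+\<omega>. F (x, \<omega>) \<partial>path_measure S p x) \<in> borel_measurable borel"
  using nn_integral_measurable_subprob_algebra2[of "\<lambda>x \<omega>. F (x, \<omega>)" borel borel "path_measure S p"] F
    measurable_prob_algebraD[OF measurable_path_measure] by simp

lemma measurable_path_measure_iff: "f \<in> path_measure S p x \<rightarrow>\<^sub>M N \<longleftrightarrow> f \<in> borel \<rightarrow>\<^sub>M N"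
  by (simp add: measurable_cong_sets[OF sets_path_measure refl])

lemma section_probability_le_1:
  "(\<integral>\<^sup>+\<omega>. indicator A (x, \<omega>) \<partial>path_measure S p x) \<le> 1"
proof -
  have "(\<integral>\<^sup>+\<omega>. indicator A (x, \<omega>) \<partial>path_measure S p x) \<le> (\<integral>\<^sup>+\<omega>. 1 \<partial>path_measure S p x)"
    by (intro nn_integral_mono) (simp add: indicator_def)
  then show ?thesis by simp
qed

definition skew_kernel :: "'a \<Rightarrow> ('a \<times> (nat \<Rightarrow> 'i)) measure" where
  "skew_kernel x = distr (path_measure S p x) product_space (Pair x)"

lemma nn_integral_skew_kernel:
  "F \<in> borel_measurable product_space \<Longrightarrow> (\<integral>\<^sup>+z. F z \<partial>skew_kernel x) = (\<integral>\<^sup>+\<omega>. F (x, \<omega>) \<partial>path_measure S p x)"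
  unfolding skew_kernel_def by (rule nn_integral_distr) (simp_all add: measurable_path_measure_iff)

lemma measurable_skew_kernel: "skew_kernel \<in> borel \<rightarrow>\<^sub>M prob_algebra product_space"
proof (rule measurable_prob_algebra_generated[OF refl[THEN trans, OF sets.sigma_sets_eq[symmetric]] sets.Int_stable sets.space_closed])
  show "prob_space (skew_kernel x)" for x
    unfolding skew_kernel_def
    by (intro prob_space.prob_space_distr prob_space_path_measure) (simp add: measurable_path_measure_iff)
  show "sets (skew_kernel x) = sets product_space" for x
    by (simp add: skew_kernel_def)
  show "(\<lambda>x. emeasure (skew_kernel x) A) \<in> borel_measurable borel" if [measurable]: "A \<in> sets product_space" for A
  proof -
    have "emeasure (skew_kernel x) A = (\<integral>\<^sup>+\<omega>. indicator A (x, \<omega>) \<partial>path_measure S p x)" for x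
      using that nn_integral_skew_kernel[of "indicator A" x] by (simp add: skew_kernel_def)
    then show ?thesis by simp
  qed
qed

text \<open>
  Given the first \<open>n\<close> letters, the remaining sequence is a path from the point reached so far. The
  induction prescribes and removes the first letter of the word in each step; the empty word is
  allowed for every \<open>n\<close>, which covers all words shorter than \<open>n\<close>.
\<close>

lemma markov_property:
  assumes F[measurable]: "F \<in> borel_measurable product_space" and "length w \<le> n"
  defines "G \<equiv> \<lambda>x. \<integral>\<^sup>+\<omega>. F (x, \<omega>) \<partial>path_measure S p x"
  shows "(\<integral>\<^sup>+\<omega>. indicator (cylinder w) \<omega> * F ((skew_product S ^^ n) (x, \<omega>)) \<partial>path_measure S p x) =
    (\<integral>\<^sup>+\<omega>. indicator (cylinder w) \<omega> * G (fst ((skew_product S ^^ n) (x, \<omega>))) \<partial>path_measure S p x)"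
  using \<open>length w \<le> n\<close>
proof (induction n arbitrary: x w)
  case 0
  then show ?case
    by (simp add: cylinder_Nil G_def emeasure_path_measure_UNIV)
next
  case (Suc n)
  have G[measurable]: "G \<in> borel_measurable borel"
    unfolding G_def by measurable
  have [measurable]: "cylinder w \<in> sets borel"
    by (simp add: open_cylinder)
  have step: "(\<integral>\<^sup>+\<omega>. indicator (cylinder w) (case_nat i \<omega>) * F ((skew_product S ^^ n) (S i x, \<omega>)) \<partial>path_measure S p (S i x)) =
      (\<integral>\<^sup>+\<omega>. indicator (cylinder w) (case_nat i \<omega>) * G (fst ((skew_product S ^^ n) (S i x, \<omega>))) \<partial>path_measure S p (S i x))" for i
  proof (cases w)
    case Nil
    then show ?thesis using Suc.IH[of "[]" "S i x"] by (simp add: cylinder_Nil)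
  next
    case (Cons j v)
    then have "indicator (cylinder w) (case_nat i \<omega>) = (if i = j then indicator (cylinder v) \<omega> else 0 :: ennreal)" for \<omega>
      by (auto simp: cylinder_Cons indicator_def)
    then show ?thesis
      using Suc.IH[of v "S i x"] Suc.prems Cons by (cases "i = j") simp_all
  qed
  show ?case
    by (subst (1 2) nn_integral_path_measure) (simp_all add: step funpow_Suc_right del: funpow.simps)
qed

end

locale ifs_measure = ifs_system S p + prob_space \<mu>
  for S :: "'i::{finite,discrete_topology} \<Rightarrow> 'a::topological_space \<Rightarrow> 'a" and p and \<mu> :: "'a measure" +
  assumes sets_\<mu> [simp, measurable_cong]: "sets \<mu> = sets borel"
begin

lemma space_\<mu> [simp]: "space \<mu> = UNIV"
  using sets_eq_imp_space_eq[OF sets_\<mu>] by simp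

abbreviation \<nu> where "\<nu> \<equiv> skew_measure S p \<mu>"

lemma \<mu>_in_prob_algebra: "\<mu> \<in> space (prob_algebra borel)"
  by (simp add: space_prob_algebra prob_space_axioms)

text \<open>
  Here the Borel sigma-algebra in the definition of the skew measure meets the product
  sigma-algebra on which the kernel is measurable.
\<close>

lemma skew_measure_eq_bind: "\<nu> = \<mu> \<bind> skew_kernel"
  unfolding skew_measure_def
proof (rule measure_of_eq_measureI)
  have *: "sets (\<mu> \<bind> skew_kernel) = sets product_space"
    by (rule sets_bind'[OF \<mu>_in_prob_algebra measurable_skew_kernel])
  also have "\<dots> = sets borel"
    by (rule borel_prod_sequences)
  finally show "sets (\<mu> \<bind> skew_kernel) = sets borel" .
  fix A :: "('a \<times> (nat \<Rightarrow> 'i)) set" assume "A \<in> sets borel"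
  then have A: "A \<in> sets product_space"
    by (simp add: borel_prod_sequences)
  have "emeasure (skew_kernel x) A = emeasure (path_measure S p x) {\<omega>. (x, \<omega>) \<in> A}" for x
    unfolding skew_kernel_def using A by (subst emeasure_distr) (simp_all add: measurable_path_measure_iff vimage_def)
  then show "emeasure (\<mu> \<bind> skew_kernel) A = (\<integral>\<^sup>+x. emeasure (path_measure S p x) {\<omega>. (x, \<omega>) \<in> A} \<partial>\<mu>)"
    using emeasure_bind_prob_algebra[OF \<mu>_in_prob_algebra measurable_skew_kernel A] by simp
qed

lemma sets_\<nu> [simp, measurable_cong]: "sets \<nu> = sets product_space"
  unfolding skew_measure_eq_bind by (rule sets_bind'[OF \<mu>_in_prob_algebra measurable_skew_kernel])

lemma space_\<nu> [simp]: "space \<nu> = UNIV"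
  using sets_eq_imp_space_eq[OF sets_\<nu>] by (simp add: space_pair_measure)

lemma prob_space_\<nu>: "prob_space \<nu>"
  unfolding skew_measure_eq_bind by (rule prob_space_bind'[OF \<mu>_in_prob_algebra measurable_skew_kernel])

lemma nn_integral_\<nu>:
  assumes "F \<in> borel_measurable product_space"
  shows "(\<integral>\<^sup>+z. F z \<partial>\<nu>) = (\<integral>\<^sup>+x. \<integral>\<^sup>+\<omega>. F (x, \<omega>) \<partial>path_measure S p x \<partial>\<mu>)"
proof -
  have "skew_kernel \<in> \<mu> \<rightarrow>\<^sub>M subprob_algebra product_space"
    using measurable_prob_algebraD[OF measurable_skew_kernel] by (simp add: measurable_cong_sets[OF sets_\<mu> refl])
  then show ?thesis
    unfolding skew_measure_eq_bind by (simp add: nn_integral_bind[OF assms] nn_integral_skew_kernel[OF assms])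
qed

lemma emeasure_\<nu>:
  assumes [measurable]: "A \<in> sets product_space"
  shows "emeasure \<nu> A = (\<integral>\<^sup>+x. \<integral>\<^sup>+\<omega>. indicator A (x, \<omega>) \<partial>path_measure S p x \<partial>\<mu>)"
proof -
  have "emeasure \<nu> A = (\<integral>\<^sup>+z. indicator A z \<partial>\<nu>)" by simp
  also have "\<dots> = (\<integral>\<^sup>+x. \<integral>\<^sup>+\<omega>. indicator A (x, \<omega>) \<partial>path_measure S p x \<partial>\<mu>)"
    by (rule nn_integral_\<nu>) measurable
  finally show ?thesis .
qed

lemma emeasure_\<nu>_eq_0_iff:
  assumes [measurable]: "A \<in> sets product_space"
  shows "emeasure \<nu> A = 0 \<longleftrightarrow> (AE x in \<mu>. (\<integral>\<^sup>+\<omega>. indicator A (x, \<omega>) \<partial>path_measure S p x) = 0)"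
proof -
  have "emeasure \<nu> A = (\<integral>\<^sup>+x. \<integral>\<^sup>+\<omega>. indicator A (x, \<omega>) \<partial>path_measure S p x \<partial>\<mu>)"
    by (rule emeasure_\<nu>) (rule assms)
  then show ?thesis
    by (simp only:) (rule nn_integral_0_iff_AE, measurable)
qed

lemma nn_integral_\<nu>_fst:
  assumes [measurable]: "f \<in> borel_measurable borel"
  shows "(\<integral>\<^sup>+z. f (fst z) \<partial>\<nu>) = (\<integral>\<^sup>+x. f x \<partial>\<mu>)"
  by (subst nn_integral_\<nu>) (simp_all add: emeasure_path_measure_UNIV)

lemma nn_integral_\<nu>_step:
  assumes F[measurable]: "F \<in> borel_measurable product_space"
  shows "(\<integral>\<^sup>+z. F (skew_product S z) \<partial>\<nu>) =
    (\<integral>\<^sup>+x. (\<Sum>i\<in>UNIV. ennreal (p i x) * (\<integral>\<^sup>+\<omega>. F (S i x, \<omega>) \<partial>path_measure S p (S i x))) \<partial>\<mu>)"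
  by (subst nn_integral_\<nu>, measurable, subst nn_integral_path_measure) simp_all

text \<open>
  One step of the Markov chain is the first coordinate of one step of the skew product.
\<close>

lemma ifs_action_eq_distr: "ifs_action S p \<mu> = distr \<nu> borel (\<lambda>z. fst (skew_product S z))"
  unfolding ifs_action_def
proof (rule measure_of_eq_measureI)
  fix A :: "'a set" assume A[measurable]: "A \<in> sets borel"
  have "emeasure (distr \<nu> borel (\<lambda>z. fst (skew_product S z))) A =
      (\<integral>\<^sup>+y. indicator A y \<partial>distr \<nu> borel (\<lambda>z. fst (skew_product S z)))"
    by simp
  also have "\<dots> = (\<integral>\<^sup>+z. indicator A (fst (skew_product S z)) \<partial>\<nu>)"
    by (rule nn_integral_distr) simp_all
  also have "\<dots> = (\<integral>\<^sup>+x. (\<Sum>i\<in>UNIV. ennreal (p i x) * indicator A (S i x)) \<partial>\<mu>)"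
    using nn_integral_\<nu>_step[of "\<lambda>z. indicator A (fst z)"]
    by (simp add: emeasure_path_measure_UNIV)
  also have "\<dots> = (\<integral>\<^sup>+x. ennreal (ifs_transition S p x A) \<partial>\<mu>)"
    by (simp add: ifs_transition_def ennreal_mult ennreal_indicator flip: sum_ennreal)
  finally show "emeasure (distr \<nu> borel (\<lambda>z. fst (skew_product S z))) A =
      (\<integral>\<^sup>+x. ennreal (ifs_transition S p x A) \<partial>\<mu>)" .
qed simp

lemma nn_integral_ifs_action:
  assumes [measurable]: "f \<in> borel_measurable borel"
  shows "(\<integral>\<^sup>+x. f x \<partial>ifs_action S p \<mu>) = (\<integral>\<^sup>+x. (\<Sum>i\<in>UNIV. ennreal (p i x) * f (S i x)) \<partial>\<mu>)"
  unfolding ifs_action_eq_distr using nn_integral_\<nu>_step[of "\<lambda>z. f (fst z)"]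
  by (subst nn_integral_distr)
    (simp_all add: emeasure_path_measure_UNIV)

end

context ifs_system
begin

lemma ifs_measureI: "prob_space \<mu> \<Longrightarrow> sets \<mu> = sets borel \<Longrightarrow> ifs_measure S p \<mu>"
  by (simp add: ifs_measure_def ifs_measure_axioms_def ifs_system_axioms)

end

locale invariant_ifs_measure = ifs_system S p
  for S :: "'i::{finite,discrete_topology} \<Rightarrow> 'a::topological_space \<Rightarrow> 'a" and p +
  fixes \<mu> :: "'a measure"
  assumes invariant: "\<mu> \<in> ifs_invariant_probs S p"

sublocale invariant_ifs_measure \<subseteq> ifs_measure S p \<mu>
  using invariant by (intro ifs_measureI) (auto simp: ifs_invariant_probs_def)

context invariant_ifs_measure
begin

text \<open>
  Invariance of \<open>\<mu>\<close>, tested against functions in place of sets.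
\<close>

lemma nn_integral_transition:
  assumes "f \<in> borel_measurable borel"
  shows "(\<integral>\<^sup>+x. (\<Sum>i\<in>UNIV. ennreal (p i x) * f (S i x)) \<partial>\<mu>) = (\<integral>\<^sup>+x. f x \<partial>\<mu>)"
  using nn_integral_ifs_action[OF assms] invariant by (simp add: ifs_invariant_probs_def)

lemma nn_integral_skew_product:
  assumes [measurable]: "F \<in> borel_measurable product_space"
  shows "(\<integral>\<^sup>+z. F (skew_product S z) \<partial>\<nu>) = (\<integral>\<^sup>+z. F z \<partial>\<nu>)"
proof -
  have "(\<integral>\<^sup>+z. F (skew_product S z) \<partial>\<nu>) = (\<integral>\<^sup>+x. \<integral>\<^sup>+\<omega>. F (x, \<omega>) \<partial>path_measure S p x \<partial>\<mu>)"
    by (simp add: nn_integral_\<nu>_step nn_integral_transition[of "\<lambda>x. \<integral>\<^sup>+\<omega>. F (x, \<omega>) \<partial>path_measure S p x"])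
  then show ?thesis by (simp add: nn_integral_\<nu>)
qed

lemma measurable_skew_\<nu> [measurable]: "skew_product S \<in> \<nu> \<rightarrow>\<^sub>M \<nu>"
  by (simp add: measurable_cong_sets[OF sets_\<nu> sets_\<nu>])

lemma distr_skew_product: "distr \<nu> \<nu> (skew_product S) = \<nu>"
proof (rule measure_eqI)
  fix A assume "A \<in> sets (distr \<nu> \<nu> (skew_product S))"
  then have [measurable]: "A \<in> sets product_space" by simp
  have "emeasure (distr \<nu> \<nu> (skew_product S)) A = (\<integral>\<^sup>+z. indicator A z \<partial>distr \<nu> \<nu> (skew_product S))"
    by simp
  also have "\<dots> = (\<integral>\<^sup>+z. indicator A (skew_product S z) \<partial>\<nu>)"
    by (rule nn_integral_distr) simp_all
  also have "\<dots> = emeasure \<nu> A"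
    by (simp add: nn_integral_skew_product)
  finally show "emeasure (distr \<nu> \<nu> (skew_product S)) A = emeasure \<nu> A" .
qed simp

lemma nn_integral_skew_power:
  assumes [measurable]: "F \<in> borel_measurable product_space"
  shows "(\<integral>\<^sup>+z. F ((skew_product S ^^ n) z) \<partial>\<nu>) = (\<integral>\<^sup>+z. F z \<partial>\<nu>)"
proof (induction n)
  case (Suc n)
  have "(\<integral>\<^sup>+z. F ((skew_product S ^^ n) (skew_product S z)) \<partial>\<nu>) = (\<integral>\<^sup>+z. F ((skew_product S ^^ n) z) \<partial>\<nu>)"
    by (rule nn_integral_skew_product) measurable
  with Suc show ?case by (simp add: funpow_swap1)
qed simp

section \<open>From the skew product to the function system\<close>

lemma ifs_ergodic_if_skew_ergodic:
  assumes erg: "ergodic_transformation \<nu> (skew_product S)"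
  shows "ifs_ergodic S p \<mu>"
proof -
  have "\<mu>1 = \<mu>2" if \<mu>1: "\<mu>1 \<in> ifs_invariant_probs S p" and \<mu>2: "\<mu>2 \<in> ifs_invariant_probs S p"
    and t: "0 < t" "t < 1"
    and conv: "\<forall>A\<in>sets borel. measure \<mu> A = t * measure \<mu>1 A + (1 - t) * measure \<mu>2 A" for \<mu>1 \<mu>2 t
  proof -
    interpret M1: invariant_ifs_measure S p \<mu>1 by unfold_locales (rule \<mu>1)
    interpret M2: invariant_ifs_measure S p \<mu>2 by unfold_locales (rule \<mu>2)
    interpret N: prob_space \<nu> by (rule prob_space_\<nu>)
    interpret N1: prob_space M1.\<nu> by (rule M1.prob_space_\<nu>)
    interpret N2: prob_space M2.\<nu> by (rule M2.prob_space_\<nu>)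
    \<comment> \<open>Both weights of the convex combination are positive, so null sets of \<open>\<mu>\<close> are null for both parts.\<close>
    have null: "measure \<mu>1 A = 0 \<and> measure \<mu>2 A = 0" if "A \<in> sets borel" "measure \<mu> A = 0" for A
    proof -
      have "t * measure \<mu>1 A \<ge> 0" "(1 - t) * measure \<mu>2 A \<ge> 0" using t by simp_all
      with conv that have "t * measure \<mu>1 A = 0" "(1 - t) * measure \<mu>2 A = 0" by (smt (verit))+
      with t show ?thesis by simp
    qed
    have "absolutely_continuous \<mu> \<mu>1" "absolutely_continuous \<mu> \<mu>2"
      unfolding absolutely_continuous_def null_sets_def
      using null by (auto simp: emeasure_eq_measure M1.emeasure_eq_measure M2.emeasure_eq_measure)
    then have AE: "(AE x in \<mu>1. P x) \<and> (AE x in \<mu>2. P x)" if "AE x in \<mu>. P x" for P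
      using that absolutely_continuous_AE[of \<mu>1 \<mu> P] absolutely_continuous_AE[of \<mu>2 \<mu> P] by simp
    have null_\<nu>: "measure M1.\<nu> A = 0 \<and> measure M2.\<nu> A = 0" if "A \<in> sets product_space" "measure \<nu> A = 0" for A
    proof -
      have "AE x in \<mu>. (\<integral>\<^sup>+\<omega>. indicator A (x, \<omega>) \<partial>path_measure S p x) = 0"
        using that emeasure_\<nu>_eq_0_iff by (simp add: N.emeasure_eq_measure)
      from AE[OF this] show ?thesis
        using M1.emeasure_\<nu>_eq_0_iff[OF that(1)] M2.emeasure_\<nu>_eq_0_iff[OF that(1)]
        by (simp add: measure_def)
    qed
    have "M1.\<nu> = M2.\<nu>"
    proof (rule invariant_measures_eqI[where T="skew_product S"])
      fix A assume A: "A \<in> sets M1.\<nu>" "skew_product S -` A \<inter> space M1.\<nu> = A"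
      with erg have "measure \<nu> A = 0 \<or> measure \<nu> A = 1"
        by (simp add: ergodic_transformation_def)
      then show "measure M1.\<nu> A = measure M2.\<nu> A"
      proof
        assume "measure \<nu> A = 0"
        with A null_\<nu>[of A] show ?thesis by simp
      next
        assume "measure \<nu> A = 1"
        with A have "measure \<nu> (UNIV - A) = 0"
          using N.prob_compl[of A] by simp
        moreover have "UNIV - A \<in> sets product_space"
          using A sets.compl_sets[of A product_space] by (simp add: space_pair_measure)
        ultimately have "measure M1.\<nu> (UNIV - A) = 0 \<and> measure M2.\<nu> (UNIV - A) = 0"
          using null_\<nu> by blast
        with A N1.prob_compl[of A] N2.prob_compl[of A] show ?thesis by simp
      qed
    qed (simp_all add: M1.prob_space_\<nu> M2.prob_space_\<nu> M1.distr_skew_product M2.distr_skew_product)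
    show "\<mu>1 = \<mu>2"
    proof (rule measure_eqI)
      fix A assume "A \<in> sets \<mu>1"
      then have [measurable]: "A \<in> sets borel" by simp
      show "emeasure \<mu>1 A = emeasure \<mu>2 A"
        using M1.nn_integral_\<nu>_fst[of "indicator A"] M2.nn_integral_\<nu>_fst[of "indicator A"] \<open>M1.\<nu> = M2.\<nu>\<close>
        by simp
    qed simp
  qed
  then show ?thesis
    unfolding ifs_ergodic_def using invariant by blast
qed

section \<open>From the function system to the skew product\<close>

text \<open>
  The density does not change along transitions of positive probability, hence it can be moved
  inside the transition operator, where invariance of \<open>\<mu>\<close> applies.
\<close>

lemma density_invariant:
  fixes g :: "'a \<Rightarrow> real"
  assumes [measurable]: "g \<in> borel_measurable borel" and nonneg: "\<And>x. 0 \<le> g x"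
    and total: "(\<integral>\<^sup>+x. ennreal (g x) \<partial>\<mu>) = 1"
    and harm: "AE x in \<mu>. \<forall>i. p i x * g (S i x) = p i x * g x"
  shows "density \<mu> (\<lambda>x. ennreal (g x)) \<in> ifs_invariant_probs S p"
proof -
  let ?D = "density \<mu> (\<lambda>x. ennreal (g x))"
  have prob: "prob_space ?D"
    by (rule prob_spaceI) (simp add: emeasure_density total)
  then interpret D: ifs_measure S p ?D
    by (intro ifs_measureI) simp_all
  have "ifs_action S p ?D = ?D"
  proof (rule measure_eqI)
    show "sets (ifs_action S p ?D) = sets ?D" by (simp add: D.ifs_action_eq_distr)
    fix E assume "E \<in> sets (ifs_action S p ?D)"
    then have [measurable]: "E \<in> sets borel" by (simp add: D.ifs_action_eq_distr)
    have "emeasure (ifs_action S p ?D) E = (\<integral>\<^sup>+x. indicator E x \<partial>ifs_action S p ?D)"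
      by (simp add: D.ifs_action_eq_distr)
    also have "\<dots> = (\<integral>\<^sup>+x. ennreal (g x) * (\<Sum>i\<in>UNIV. ennreal (p i x) * indicator E (S i x)) \<partial>\<mu>)"
    proof -
      have "(\<integral>\<^sup>+x. indicator E x \<partial>ifs_action S p ?D) = (\<integral>\<^sup>+x. (\<Sum>i\<in>UNIV. ennreal (p i x) * indicator E (S i x)) \<partial>?D)"
        by (rule D.nn_integral_ifs_action) measurable
      also have "\<dots> = (\<integral>\<^sup>+x. ennreal (g x) * (\<Sum>i\<in>UNIV. ennreal (p i x) * indicator E (S i x)) \<partial>\<mu>)"
        by (rule nn_integral_density) measurable
      finally show ?thesis .
    qed
    also have "\<dots> = (\<integral>\<^sup>+x. (\<Sum>i\<in>UNIV. ennreal (p i x) * (ennreal (g (S i x)) * indicator E (S i x))) \<partial>\<mu>)"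
    proof (rule nn_integral_cong_AE)
      show "AE x in \<mu>. ennreal (g x) * (\<Sum>i\<in>UNIV. ennreal (p i x) * indicator E (S i x)) =
          (\<Sum>i\<in>UNIV. ennreal (p i x) * (ennreal (g (S i x)) * indicator E (S i x)))"
        using harm
      proof eventually_elim
        case (elim x)
        have "ennreal (p i x) * ennreal (g (S i x)) = ennreal (g x) * ennreal (p i x)" for i
          using elim[rule_format, of i] by (simp add: nonneg mult.commute flip: ennreal_mult)
        then show ?case
          unfolding sum_distrib_left by (simp only: mult.assoc[symmetric])
      qed
    qed
    also have "\<dots> = (\<integral>\<^sup>+x. ennreal (g x) * indicator E x \<partial>\<mu>)"
      by (rule nn_integral_transition[of "\<lambda>y. ennreal (g y) * indicator E y"]) measurable
    also have "\<dots> = emeasure ?D E"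
      by (simp add: emeasure_density)
    finally show "emeasure (ifs_action S p ?D) E = emeasure ?D E" .
  qed
  with prob show ?thesis by (simp add: ifs_invariant_probs_def)
qed

text \<open>
  The normalised densities \<open>h\<close> and \<open>1 - h\<close> give two invariant probability measures whose convex
  combination with weights \<open>a\<close> and \<open>1 - a\<close> is \<open>\<mu>\<close>. If they were equal, \<open>h\<close> would be almost
  everywhere equal to \<open>a\<close>, which is neither 0 nor 1.
\<close>

lemma not_ifs_ergodic_if_zero_one_function:
  fixes h :: "'a \<Rightarrow> real"
  assumes [measurable]: "h \<in> borel_measurable borel" and h: "\<And>x. 0 \<le> h x" "\<And>x. h x \<le> 1"
    and harm: "AE x in \<mu>. \<forall>i. p i x * h (S i x) = p i x * h x"
    and zero_one: "AE x in \<mu>. h x = 0 \<or> h x = 1"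
    and a: "(\<integral>\<^sup>+x. ennreal (h x) \<partial>\<mu>) = ennreal a" "0 < a" "a < 1"
  shows "\<not> ifs_ergodic S p \<mu>"
proof -
  let ?D1 = "density \<mu> (\<lambda>x. ennreal (h x / a))"
  let ?D2 = "density \<mu> (\<lambda>x. ennreal ((1 - h x) / (1 - a)))"
  have compl: "(\<integral>\<^sup>+x. ennreal (1 - h x) \<partial>\<mu>) = ennreal (1 - a)"
  proof -
    have "(\<integral>\<^sup>+x. ennreal (1 - h x) \<partial>\<mu>) = (\<integral>\<^sup>+x. 1 - ennreal (h x) \<partial>\<mu>)"
      using h by (simp add: ennreal_minus flip: ennreal_1)
    also have "\<dots> = (\<integral>\<^sup>+x. 1 \<partial>\<mu>) - (\<integral>\<^sup>+x. ennreal (h x) \<partial>\<mu>)"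
      using h a by (intro nn_integral_diff) (auto simp: ennreal_le_1)
    also have "\<dots> = ennreal (1 - a)"
    proof -
      have "(\<integral>\<^sup>+x. 1 \<partial>\<mu>) = 1" using emeasure_space_1 by simp
      moreover have "1 - ennreal a = ennreal (1 - a)"
        using a ennreal_minus[of a 1] by simp
      ultimately show ?thesis by (simp only: a(1))
    qed
    finally show ?thesis .
  qed
  have D1: "?D1 \<in> ifs_invariant_probs S p"
  proof (rule density_invariant)
    have "(\<integral>\<^sup>+x. ennreal (h x / a) \<partial>\<mu>) = (\<integral>\<^sup>+x. ennreal (h x) / ennreal a \<partial>\<mu>)"
      using a h by (simp add: divide_ennreal)
    also have "\<dots> = ennreal a / ennreal a"
      by (simp add: nn_integral_divide a)
    finally show "(\<integral>\<^sup>+x. ennreal (h x / a) \<partial>\<mu>) = 1" 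
      using a by (simp add: divide_ennreal)
    show "AE x in \<mu>. \<forall>i. p i x * (h (S i x) / a) = p i x * (h x / a)"
      using harm by eventually_elim simp
  qed (use a h in simp_all)
  have D2: "?D2 \<in> ifs_invariant_probs S p"
  proof (rule density_invariant)
    have "(\<integral>\<^sup>+x. ennreal ((1 - h x) / (1 - a)) \<partial>\<mu>) = (\<integral>\<^sup>+x. ennreal (1 - h x) / ennreal (1 - a) \<partial>\<mu>)"
      using a h by (simp add: divide_ennreal)
    also have "\<dots> = ennreal (1 - a) / ennreal (1 - a)"
      by (simp add: nn_integral_divide compl)
    finally show "(\<integral>\<^sup>+x. ennreal ((1 - h x) / (1 - a)) \<partial>\<mu>) = 1" 
      using a by (simp add: divide_ennreal)
    show "AE x in \<mu>. \<forall>i. p i x * ((1 - h (S i x)) / (1 - a)) = p i x * ((1 - h x) / (1 - a))"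
      using harm by eventually_elim (simp add: right_diff_distrib diff_divide_distrib)
  qed (use a h in simp_all)
  interpret D1: prob_space ?D1 using D1 by (simp add: ifs_invariant_probs_def)
  interpret D2: prob_space ?D2 using D2 by (simp add: ifs_invariant_probs_def)
  have "?D1 \<noteq> ?D2"
  proof
    assume "?D1 = ?D2"
    then have "AE x in \<mu>. ennreal (h x / a) = ennreal ((1 - h x) / (1 - a))"
      by (subst (asm) density_unique_iff) simp_all
    with zero_one have "AE x in \<mu>. False"
      by eventually_elim (use a in auto)
    then show False by simp
  qed
  moreover have "measure \<mu> A = a * measure ?D1 A + (1 - a) * measure ?D2 A" if [measurable]: "A \<in> sets borel" for A
  proof -
    have "ennreal (a * measure ?D1 A + (1 - a) * measure ?D2 A) =
        ennreal a * emeasure ?D1 A + ennreal (1 - a) * emeasure ?D2 A"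
      using a by (simp add: D1.emeasure_eq_measure D2.emeasure_eq_measure ennreal_mult ennreal_plus)
    also have "\<dots> = (\<integral>\<^sup>+x. ennreal a * (ennreal (h x / a) * indicator A x)
        + ennreal (1 - a) * (ennreal ((1 - h x) / (1 - a)) * indicator A x) \<partial>\<mu>)"
      by (simp add: emeasure_density nn_integral_add nn_integral_cmult)
    also have "\<dots> = (\<integral>\<^sup>+x. indicator A x \<partial>\<mu>)"
    proof (rule nn_integral_cong)
      fix x
      have "ennreal a * ennreal (h x / a) = ennreal (h x)"
        "ennreal (1 - a) * ennreal ((1 - h x) / (1 - a)) = ennreal (1 - h x)"
        using a h by (simp_all flip: ennreal_mult)
      then show "ennreal a * (ennreal (h x / a) * indicator A x)
          + ennreal (1 - a) * (ennreal ((1 - h x) / (1 - a)) * indicator A x) = indicator A x"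
        using h by (simp flip: mult.assoc distrib_right ennreal_plus)
    qed
    also have "\<dots> = ennreal (measure \<mu> A)"
      by (simp add: emeasure_eq_measure)
    finally show ?thesis
      using a by (subst (asm) ennreal_inj) simp_all
  qed
  ultimately show ?thesis
    unfolding ifs_ergodic_def using D1 D2 a by blast
qed

text \<open>
  A form of the martingale convergence theorem that is enough here: \<open>h (fst ((skew_product S ^^ n) z))\<close>
  is the conditional expectation of the indicator of \<open>A\<close> given \<open>x\<close> and the first \<open>n\<close> letters, and these
  conditional expectations converge weakly to the indicator itself.
\<close>

lemma density_tendsto_invariant_set:
  assumes A[measurable]: "A \<in> sets product_space" and inv: "\<And>z. skew_product S z \<in> A \<longleftrightarrow> z \<in> A"
    and B: "B \<in> sets product_space"
  defines "h \<equiv> \<lambda>x. \<integral>\<^sup>+\<omega>. indicator A (x, \<omega>) \<partial>path_measure S p x"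
  shows "(\<lambda>n. measure (density \<nu> (\<lambda>z. h (fst ((skew_product S ^^ n) z)))) B) \<longlonglongrightarrow> measure (density \<nu> (indicator A)) B"
proof -
  interpret N: prob_space \<nu> by (rule prob_space_\<nu>)
  have h[measurable]: "h \<in> borel_measurable borel"
    unfolding h_def by measurable
  have h_le_1: "h x \<le> 1" for x
    unfolding h_def by (rule section_probability_le_1)
  let ?M = "\<lambda>n. density \<nu> (\<lambda>z. h (fst ((skew_product S ^^ n) z)))" and ?L = "density \<nu> (indicator A)"
  let ?G = "{D \<times> C | D C. D \<in> sets (borel :: 'a measure) \<and> C \<in> insert {} (range (cylinder :: 'i list \<Rightarrow> _))}"
  note inv_n = funpow_mem_iff[of "skew_product S", OF inv]
  have le: "emeasure (density \<nu> f) C \<le> emeasure \<nu> C"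
    if [measurable]: "f \<in> borel_measurable product_space" "C \<in> sets product_space" and "\<And>z. f z \<le> 1" for f C
  proof -
    have "emeasure (density \<nu> f) C = (\<integral>\<^sup>+z. f z * indicator C z \<partial>\<nu>)"
      by (rule emeasure_density) measurable
    also have "\<dots> \<le> (\<integral>\<^sup>+z. indicator C z \<partial>\<nu>)"
      using that(3) by (intro nn_integral_mono) (simp split: split_indicator)
    also have "\<dots> = emeasure \<nu> C" by simp
    finally show ?thesis .
  qed
  \<comment> \<open>On a rectangle that is determined by the first \<open>n\<close> letters the limit is already attained at time \<open>n\<close>.\<close>
  have eq: "emeasure (?M n) (D \<times> cylinder w) = emeasure ?L (D \<times> cylinder w)"
    if [measurable]: "D \<in> sets borel" and "length w \<le> n" for D n and w :: "'i list"
  proof -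
    have [measurable]: "cylinder w \<in> sets borel" by (simp add: open_cylinder)
    have "emeasure (?M n) (D \<times> cylinder w) =
        (\<integral>\<^sup>+x. indicator D x * (\<integral>\<^sup>+\<omega>. indicator (cylinder w) \<omega> * h (fst ((skew_product S ^^ n) (x, \<omega>))) \<partial>path_measure S p x) \<partial>\<mu>)"
    proof -
      have "emeasure (?M n) (D \<times> cylinder w) =
          (\<integral>\<^sup>+z. h (fst ((skew_product S ^^ n) z)) * indicator (D \<times> cylinder w) z \<partial>\<nu>)"
        by (rule emeasure_density) measurable
      also have "\<dots> = (\<integral>\<^sup>+x. \<integral>\<^sup>+\<omega>. h (fst ((skew_product S ^^ n) (x, \<omega>))) * indicator (D \<times> cylinder w) (x, \<omega>) \<partial>path_measure S p x \<partial>\<mu>)"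
        by (rule nn_integral_\<nu>) measurable
      also have "\<dots> = (\<integral>\<^sup>+x. \<integral>\<^sup>+\<omega>. indicator D x * (indicator (cylinder w) \<omega> * h (fst ((skew_product S ^^ n) (x, \<omega>)))) \<partial>path_measure S p x \<partial>\<mu>)"
        by (simp add: indicator_times ac_simps)
      also have "\<dots> = (\<integral>\<^sup>+x. indicator D x * (\<integral>\<^sup>+\<omega>. indicator (cylinder w) \<omega> * h (fst ((skew_product S ^^ n) (x, \<omega>))) \<partial>path_measure S p x) \<partial>\<mu>)"
        by (intro nn_integral_cong nn_integral_cmult) (unfold measurable_path_measure_iff, measurable)
      finally show ?thesis .
    qed
    also have "\<dots> = (\<integral>\<^sup>+x. indicator D x * (\<integral>\<^sup>+\<omega>. indicator (cylinder w) \<omega> * indicator A ((skew_product S ^^ n) (x, \<omega>)) \<partial>path_measure S p x) \<partial>\<mu>)"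
      using markov_property[of "indicator A" w n] that(2) by (simp add: h_def)
    also have "\<dots> = (\<integral>\<^sup>+x. \<integral>\<^sup>+\<omega>. indicator A (x, \<omega>) * indicator (D \<times> cylinder w) (x, \<omega>) \<partial>path_measure S p x \<partial>\<mu>)"
    proof -
      have "indicator A ((skew_product S ^^ n) z) = (indicator A z :: ennreal)" for z
        by (simp add: indicator_def inv_n)
      then show ?thesis
        by (simp add: indicator_times nn_integral_cmult[symmetric] measurable_path_measure_iff ac_simps)
    qed
    also have "\<dots> = emeasure ?L (D \<times> cylinder w)"
      by (subst emeasure_density) (simp_all add: nn_integral_\<nu>)
    finally show ?thesis .
  qed
  have fin: "finite_measure (density \<nu> f)" if [measurable]: "f \<in> borel_measurable product_space" and "\<And>z. f z \<le> 1" for f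
  proof (rule finite_measureI)
    show "emeasure (density \<nu> f) (space (density \<nu> f)) \<noteq> \<infinity>"
      using le[of f UNIV] that N.emeasure_space_1 sets.top[of product_space]
      by (auto simp: space_pair_measure top_unique)
  qed
  have ind_le: "indicator A z \<le> (1::ennreal)" for z
    by (simp add: indicator_def)
  have G_stable: "Int_stable ?G"
  proof (rule Int_stableI)
    fix a b assume "a \<in> ?G" "b \<in> ?G"
    then obtain D C D' C' where *: "a = D \<times> C" "b = D' \<times> C'" "D \<in> sets borel" "D' \<in> sets borel"
      "C \<in> insert {} (range cylinder)" "C' \<in> insert {} (range cylinder)" by blast
    then have "a \<inter> b = (D \<inter> D') \<times> (C \<inter> C')" by auto
    moreover have "C \<inter> C' \<in> insert {} (range cylinder)"
      using Int_stableD[OF Int_stable_cylinders] * by blast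
    ultimately show "a \<inter> b \<in> ?G" using * by blast
  qed
  have lim_cyl: "(\<lambda>n. measure (?M n) (D \<times> cylinder w)) \<longlonglongrightarrow> measure ?L (D \<times> cylinder w)"
    if "D \<in> sets borel" for D and w :: "'i list"
    by (intro tendsto_eventually eventually_sequentiallyI[of "length w"]) (simp add: measure_def eq that)
  show ?thesis
  proof (rule tendsto_measure_generator[where G="?G" and \<Omega>=UNIV and N=\<nu>])
    show "finite_measure (?M n)" for n by (intro fin h_le_1) measurable
    show "finite_measure ?L" by (intro fin ind_le) measurable
    show "finite_measure \<nu>" by (rule N.finite_measure_axioms)
    show "measure (?M n) C \<le> measure \<nu> C" if "C \<in> sigma_sets UNIV ?G" for n C
    proof -
      have "emeasure (?M n) C \<le> emeasure \<nu> C"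
        using that by (intro le h_le_1) (simp_all add: sets_pair_cylinders)
      then show ?thesis
        unfolding measure_def by (rule enn2real_mono) (simp add: N.emeasure_eq_measure)
    qed
    show "(\<lambda>n. measure (?M n) C) \<longlonglongrightarrow> measure ?L C" if "C \<in> ?G" for C
      using that lim_cyl by auto
    show "(\<lambda>n. measure (?M n) UNIV) \<longlonglongrightarrow> measure ?L UNIV"
      using lim_cyl[of UNIV "[]"] by (simp add: cylinder_Nil)
  qed (use G_stable B in \<open>simp_all add: sets_pair_cylinders\<close>)
qed

lemma skew_ergodic_if_ifs_ergodic:
  assumes erg: "ifs_ergodic S p \<mu>"
  shows "ergodic_transformation \<nu> (skew_product S)"
proof -
  interpret N: prob_space \<nu> by (rule prob_space_\<nu>)
  have "measure \<nu> A = 0 \<or> measure \<nu> A = 1"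
    if A: "A \<in> sets \<nu>" "skew_product S -` A \<inter> space \<nu> = A" for A
  proof (rule ccontr)
    assume not: "\<not> (measure \<nu> A = 0 \<or> measure \<nu> A = 1)"
    have [measurable]: "A \<in> sets product_space" using A by simp
    have inv: "skew_product S z \<in> A \<longleftrightarrow> z \<in> A" for z using A(2) by auto
    define h where "h x = (\<integral>\<^sup>+\<omega>. indicator A (x, \<omega>) \<partial>path_measure S p x)" for x
    have [measurable]: "h \<in> borel_measurable borel"
      unfolding h_def by measurable
    have h_le_1: "h x \<le> 1" for x
      unfolding h_def by (rule section_probability_le_1)
    define g where "g x = enn2real (h x)" for x
    have h_eq: "h x = ennreal (g x)" for x
      unfolding g_def using order_le_less_trans[OF h_le_1[of x] ennreal_one_less_top] by simp
    have g: "0 \<le> g x" "g x \<le> 1" for x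
      using h_le_1[of x] by (simp_all add: g_def enn2real_leI)
    have [measurable]: "g \<in> borel_measurable borel"
      unfolding g_def by measurable
    have int_h: "(\<integral>\<^sup>+x. h x \<partial>\<mu>) = ennreal (measure \<nu> A)"
      using emeasure_\<nu>[of A] by (simp add: h_def N.emeasure_eq_measure)
    \<comment> \<open>The value at \<open>A\<close> of the converging measures is \<open>\<integral>h\<^sup>2 d\<mu>\<close> at every time, so it equals its limit.\<close>
    have int_hh: "(\<integral>\<^sup>+x. h x * h x \<partial>\<mu>) = ennreal (measure \<nu> A)"
    proof -
      note inv_n = funpow_mem_iff[of "skew_product S", OF inv]
      have "emeasure (density \<nu> (\<lambda>z. h (fst ((skew_product S ^^ n) z)))) A = (\<integral>\<^sup>+x. h x * h x \<partial>\<mu>)" for n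
      proof -
        have "emeasure (density \<nu> (\<lambda>z. h (fst ((skew_product S ^^ n) z)))) A =
            (\<integral>\<^sup>+z. h (fst ((skew_product S ^^ n) z)) * indicator A ((skew_product S ^^ n) z) \<partial>\<nu>)"
          by (subst emeasure_density) (simp_all add: indicator_def inv_n)
        also have "\<dots> = (\<integral>\<^sup>+z. h (fst z) * indicator A z \<partial>\<nu>)"
          by (rule nn_integral_skew_power[of "\<lambda>z. h (fst z) * indicator A z"]) measurable
        also have "\<dots> = (\<integral>\<^sup>+x. h x * h x \<partial>\<mu>)"
          by (simp add: nn_integral_\<nu> nn_integral_cmult measurable_path_measure_iff flip: h_def)
        finally show ?thesis .
      qed
      moreover have "emeasure (density \<nu> (indicator A)) A = emeasure \<nu> A"
        by (simp add: emeasure_density flip: indicator_inter_arith)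
      ultimately have "enn2real (\<integral>\<^sup>+x. h x * h x \<partial>\<mu>) = measure \<nu> A"
        using density_tendsto_invariant_set[of A A, OF _ inv] by (simp add: measure_def LIMSEQ_const_iff flip: h_def)
      moreover have "(\<integral>\<^sup>+x. h x * h x \<partial>\<mu>) \<le> (\<integral>\<^sup>+x. h x \<partial>\<mu>)"
        using mult_left_mono[OF h_le_1, of "h _"] by (intro nn_integral_mono) simp
      ultimately show ?thesis
        by (metis ennreal_enn2real_if ennreal_less_top int_h linorder_not_less top.extremum_strict infinity_ennreal_def)
    qed
    have zero_one: "AE x in \<mu>. g x = 0 \<or> g x = 1"
    proof -
      have "(\<integral>\<^sup>+x. h x - h x * h x \<partial>\<mu>) = 0"
        using mult_left_mono[OF h_le_1, of "h _"]
        by (subst nn_integral_diff) (simp_all add: int_h int_hh)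
      then have "AE x in \<mu>. h x - h x * h x = 0"
        by (subst (asm) nn_integral_0_iff_AE) simp_all
      then show ?thesis
      proof eventually_elim
        case (elim x)
        then have "ennreal (g x - g x * g x) = 0"
          using g[of x] by (simp add: h_eq ennreal_minus flip: ennreal_mult)
        then have "g x - g x * g x \<le> 0" by (simp add: ennreal_eq_0_iff)
        moreover have "g x * g x \<le> g x" using g[of x] mult_left_mono[of "g x" 1 "g x"] by simp
        ultimately have "g x * (1 - g x) = 0" by (simp add: algebra_simps)
        then show ?case by auto
      qed
    qed
    \<comment> \<open>The first-step decomposition for an invariant set; with \<open>zero_one\<close> it makes \<open>g\<close> constant along transitions: an average of numbers in \<open>[0, 1]\<close> is extreme only if all those of positive weight are.\<close>
    have harmonic: "g x = (\<Sum>i\<in>UNIV. p i x * g (S i x))" for x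
    proof -
      have "h x = (\<Sum>i\<in>UNIV. ennreal (p i x) * h (S i x))"
      proof -
        have "indicator A (x, case_nat i \<omega>) = (indicator A (S i x, \<omega>) :: ennreal)" for i \<omega>
          using inv[of "(x, case_nat i \<omega>)"] by (simp add: indicator_def)
        then show ?thesis
          unfolding h_def by (subst nn_integral_path_measure) simp_all
      qed
      then have "ennreal (g x) = ennreal (\<Sum>i\<in>UNIV. p i x * g (S i x))"
        by (simp add: h_eq g ennreal_mult flip: sum_ennreal)
      then show ?thesis
        using g by (subst (asm) ennreal_inj) (simp_all add: sum_nonneg)
    qed
    have "AE x in \<mu>. \<forall>i. p i x * g (S i x) = p i x * g x"
      using zero_one
    proof eventually_elim
      case (elim x)
      then show ?case
      proof
        assume "g x = 0"
        with harmonic[of x] have "p i x * g (S i x) = 0" for i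
          using g by (simp add: sum_nonneg_eq_0_iff)
        with \<open>g x = 0\<close> show ?case by simp
      next
        assume "g x = 1"
        with harmonic[of x] sum_weights[of x] have "(\<Sum>i\<in>UNIV. p i x * (1 - g (S i x))) = 0"
          by (simp add: right_diff_distrib sum_subtractf)
        then have "p i x * (1 - g (S i x)) = 0" for i
          using g by (subst (asm) sum_nonneg_eq_0_iff) (auto simp del: mult_eq_0_iff)
        with \<open>g x = 1\<close> show ?case by (auto simp: algebra_simps)
      qed
    qed
    moreover have "0 < measure \<nu> A" "measure \<nu> A < 1"
      using not N.prob_le_1[of A] by (auto simp: less_le)
    ultimately have "\<not> ifs_ergodic S p \<mu>"
      using g zero_one int_h by (intro not_ifs_ergodic_if_zero_one_function[of g "measure \<nu> A"]) (simp_all add: h_eq)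
    with erg show False by simp
  qed
  then show ?thesis
    unfolding ergodic_transformation_def by (simp add: prob_space_\<nu> distr_skew_product)
qed

end

section \<open>Ergodicity of the system and of the skew product\<close>

theorem lemma5:
  fixes S :: "'i::{finite,discrete_topology} \<Rightarrow> 'a::metric_space \<Rightarrow> 'a"
    and p :: "'i \<Rightarrow> 'a \<Rightarrow> real"
    and \<mu> :: "'a measure"
  assumes "separable_space (euclidean :: 'a topology)"
    and "CARD('i) \<ge> 2"
    and "measurable_ifs S p"
    and "\<mu> \<in> ifs_invariant_probs S p"
  shows "ifs_ergodic S p \<mu> \<longleftrightarrow> ergodic_transformation (skew_measure S p \<mu>) (skew_product S)"
proof -
  interpret invariant_ifs_measure S p \<mu>
    by unfold_locales (fact assms)+
  show ?thesis
    using ifs_ergodic_if_skew_ergodic skew_ergodic_if_ifs_ergodic by blast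
qed

end
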